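(* For each fixed $\varepsilon>0$ and fixed $p$ with $0<p<1$ the following holds. If $r=r(n)$ satisfies $nr^2 \ge n^\varepsilon$, then with probability tending to $1$ as $n\to\infty$, the graph $G=G(n,r,p)$ satisfies \[ \alpha(G) = \Theta\left(r^{-2}\log_{1/(1-p)}(nr^2)\right), \] where $\alpha(G)$ is the independence number of $G$.
   Context: The random graph $G(n,r,p)$ is defined as follows. Place $n$ points independently and uniformly at random in the unit torus $[0,1]^2$ (opposite sides identified), and join two points by an edge if their distance in the torus metric is at most $r$; this is the random geometric graph $G(n,r)$. Independently, let $G(n,p)$ be the Erdős–Rényi random graph on the same $n$ vertices, where each pair is an edge independently with probability $p$. Then $G(n,r,p)=G(n,r)\cap G(n,p)$. The $\Theta$ means bounded above and below by positive constant multiples (constants not depending on $n$).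
   Formalization: The radius r(n) is assumed positive and bounded by an arbitrary fixed R for all large n, and the constants in Θ may depend on R; without a bound on r the claim fails, e.g. for r(n)=n, where α(G)≥1 but r^{-2}log(nr^2)→0. *)

theory Defs
  imports "HOL-Probability.Probability"
begin

definition unit_square :: "(real \<times> real) set" where
  "unit_square = {0..1} \<times> {0..1}"

text \<open>The quotient metric of the torus obtained from the plane by dividing out integer
  translations, i.e. the unit square with opposite sides identified.\<close>

definition torus_dist :: "real \<times> real \<Rightarrow> real \<times> real \<Rightarrow> real" where
  "torus_dist x y = (INF (k, l)\<in>(UNIV :: (int \<times> int) set). dist x (y + (of_int k, of_int l)))"

lemma circle_dist_le:
  fixes d :: real
  assumes "\<bar>d\<bar> \<le> 1"
  shows "min \<bar>d\<bar> (1 - \<bar>d\<bar>) \<le> \<bar>d - of_int k\<bar>"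
proof -
  consider "k = 0" | "k \<ge> 1" | "k \<le> -1" by linarith
  then show ?thesis
  proof cases
    case 2
    then have "of_int k \<ge> (1::real)" by simp
    with assms show ?thesis by linarith
  next
    case 3
    then have "of_int k \<le> (-1::real)" by linarith
    with assms show ?thesis by linarith
  qed simp
qed

lemma circle_dist_attained:
  fixes d :: real
  assumes "\<bar>d\<bar> \<le> 1"
  obtains k :: int where "\<bar>d - of_int k\<bar> = min \<bar>d\<bar> (1 - \<bar>d\<bar>)"
proof -
  consider "\<bar>d\<bar> \<le> 1 - \<bar>d\<bar>" | "\<bar>d\<bar> > 1 - \<bar>d\<bar>" "d \<ge> 0" | "\<bar>d\<bar> > 1 - \<bar>d\<bar>" "d < 0"
    by linarith
  then show thesis
  proof cases
    case 1 then show ?thesis using that[of 0] by simp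
  next
    case 2 then show ?thesis using assms that[of 1] by (simp add: min_def)
  next
    case 3 then show ?thesis using assms that[of "-1"] by (simp add: min_def)
  qed
qed

lemma torus_dist_unit_square:
  assumes "x \<in> unit_square" "y \<in> unit_square"
  defines "a \<equiv> fst x - fst y" and "b \<equiv> snd x - snd y"
  shows "torus_dist x y = sqrt ((min \<bar>a\<bar> (1 - \<bar>a\<bar>))\<^sup>2 + (min \<bar>b\<bar> (1 - \<bar>b\<bar>))\<^sup>2)"
proof -
  have ab: "\<bar>a\<bar> \<le> 1" "\<bar>b\<bar> \<le> 1"
    using assms(1,2) by (auto simp: a_def b_def unit_square_def)
  have eq: "dist x (y + (of_int k, of_int l)) = sqrt (\<bar>a - of_int k\<bar>\<^sup>2 + \<bar>b - of_int l\<bar>\<^sup>2)" for k l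
    by (cases x; cases y) (simp add: dist_Pair_Pair dist_real_def a_def b_def algebra_simps)
  obtain k l where kl: "\<bar>a - of_int k\<bar> = min \<bar>a\<bar> (1 - \<bar>a\<bar>)" "\<bar>b - of_int l\<bar> = min \<bar>b\<bar> (1 - \<bar>b\<bar>)"
    using circle_dist_attained ab by metis
  show ?thesis
    unfolding torus_dist_def
  proof (rule cInf_eq_minimum)
    show "sqrt ((min \<bar>a\<bar> (1 - \<bar>a\<bar>))\<^sup>2 + (min \<bar>b\<bar> (1 - \<bar>b\<bar>))\<^sup>2)
      \<in> range (\<lambda>(k, l). dist x (y + (of_int k, of_int l)))"
      using eq[of k l] kl by (intro image_eqI[of _ _ "(k, l)"]) auto
  next
    fix z assume "z \<in> range (\<lambda>(k, l). dist x (y + (of_int k, of_int l)))"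
    then obtain k' l' where z: "z = dist x (y + (of_int k', of_int l'))" by auto
    show "sqrt ((min \<bar>a\<bar> (1 - \<bar>a\<bar>))\<^sup>2 + (min \<bar>b\<bar> (1 - \<bar>b\<bar>))\<^sup>2) \<le> z"
      unfolding z eq using ab
      by (intro real_sqrt_le_mono add_mono power_mono circle_dist_le) auto
  qed
qed

text \<open>Graphs on the vertex set \<open>{..<n}\<close> are represented by their edge sets, whose elements are
  two-element sets of vertices.\<close>

definition vertex_pairs :: "nat \<Rightarrow> nat set set" where
  "vertex_pairs n = {e. e \<subseteq> {..<n} \<and> card e = 2}"

definition geometric_graph :: "nat \<Rightarrow> real \<Rightarrow> (nat \<Rightarrow> real \<times> real) \<Rightarrow> nat set set" where
  "geometric_graph n r X =
     {e. \<exists>i j. e = {i, j} \<and> i < n \<and> j < n \<and> i \<noteq> j \<and> torus_dist (X i) (X j) \<le> r}"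

definition coin_graph :: "nat \<Rightarrow> (nat set \<Rightarrow> bool) \<Rightarrow> nat set set" where
  "coin_graph n B = {e \<in> vertex_pairs n. B e}"

definition points_measure :: "nat \<Rightarrow> (nat \<Rightarrow> real \<times> real) measure" where
  "points_measure n = (\<Pi>\<^sub>M i\<in>{..<n}. uniform_measure lborel unit_square)"

definition coins_measure :: "nat \<Rightarrow> real \<Rightarrow> (nat set \<Rightarrow> bool) measure" where
  "coins_measure n p = (\<Pi>\<^sub>M e\<in>vertex_pairs n. measure_pmf (bernoulli_pmf p))"

definition random_graph_space ::
    "nat \<Rightarrow> real \<Rightarrow> ((nat \<Rightarrow> real \<times> real) \<times> (nat set \<Rightarrow> bool)) measure" where
  "random_graph_space n p = points_measure n \<Otimes>\<^sub>M coins_measure n p"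

definition random_graph ::
    "nat \<Rightarrow> real \<Rightarrow> (nat \<Rightarrow> real \<times> real) \<times> (nat set \<Rightarrow> bool) \<Rightarrow> nat set set" where
  "random_graph n r \<omega> = geometric_graph n r (fst \<omega>) \<inter> coin_graph n (snd \<omega>)"

definition independent_set :: "'a set \<Rightarrow> 'a set set \<Rightarrow> 'a set \<Rightarrow> bool" where
  "independent_set V E S \<longleftrightarrow> S \<subseteq> V \<and> (\<forall>u\<in>S. \<forall>v\<in>S. {u, v} \<notin> E)"

definition independence_number :: "'a set \<Rightarrow> 'a set set \<Rightarrow> nat" where
  "independence_number V E = Max {card S | S. independent_set V E S}"

end

theory Submission
  imports Defs "HOL-Real_Asymp.Real_Asymp"
begin

text \<open>Write \<open>N = n r\<^sup>2\<close>, \<open>q = 1 - p\<close> and \<open>L = log\<^bsub>1/q\<^esub> N\<close>.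

  Upper bound: cover the torus by \<open>m\<^sup>2\<close> cells of diameter at most \<open>r\<close>, with \<open>m\<close> of order \<open>1/r\<close>.
  An independent set with more than \<open>m\<^sup>2 k\<close> elements has \<open>k + 1\<close> of them in one cell, where they
  must be pairwise unjoined by coins. The expected number of such \<open>(k + 1)\<close>-sets is at most
  \<open>m\<^sup>2 (n / m\<^sup>2)\<^bsup>k+1\<^esup> q\<^bsup>k(k+1)/2\<^esup>\<close>, which is small once \<open>k \<ge> 4 L\<close>; no concentration of the
  number of points in a cell is needed.

  Lower bound: choose about \<open>1/r\<^sup>2\<close> cells of area \<open>a\<close> of order \<open>r\<^sup>2\<close> at mutual distance more than
  \<open>r\<close>; independent sets in different cells can then be united. If every coin-independent set in a
  cell has at most \<open>k\<close> elements, a maximum one, \<open>I\<close>, is dominating: every other vertex whose point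
  lies in the cell has a coin edge to \<open>I\<close>. For a fixed \<open>I\<close> this has probability
  \<open>(1 - a q\<^bsup>|I|\<^esup>)\<^bsup>n-|I|\<^esup>\<close>, at most about \<open>exp (- a n q\<^bsup>k\<^esup>)\<close>. With \<open>k = \<lfloor>L/2\<rfloor>\<close> this is \<open>exp (- c \<surd>N)\<close>,
  which beats the roughly \<open>n\<^bsup>k\<^esup>\<close> choices of \<open>I\<close> because \<open>N \<ge> n\<^bsup>\<epsilon>\<^esup>\<close>.\<close>

subsection \<open>Probabilities of elementary events\<close>

abbreviation uniform_point :: "(real \<times> real) measure" where
  "uniform_point \<equiv> uniform_measure lborel unit_square"

abbreviation coin :: "real \<Rightarrow> bool measure" where
  "coin p \<equiv> measure_pmf (bernoulli_pmf p)"

lemma closed_rectangle_eq_cbox: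
  fixes a b c d :: real
  shows "{a..b} \<times> {c..d} = cbox (a, c) (b, d)"
  by (simp add: cbox_Pair_eq)

lemma emeasure_lborel_rectangle:
  fixes a b c d :: real
  assumes "a \<le> b" "c \<le> d"
  shows "emeasure lborel ({a..b} \<times> {c..d}) = ennreal ((b - a) * (d - c))"
  using assms
  by (simp add: lborel_prod[symmetric] lborel.emeasure_pair_measure_Times ennreal_mult)

lemma emeasure_unit_square: "emeasure lborel unit_square = 1"
  by (simp add: unit_square_def emeasure_lborel_rectangle)

lemma unit_square_borel [measurable]: "unit_square \<in> sets borel"
  by (simp add: unit_square_def closed_rectangle_eq_cbox)

lemma prob_space_uniform_point: "prob_space uniform_point"
  by (rule prob_space_uniform_measure) (simp_all add: emeasure_unit_square)

lemma measure_uniform_point_rectangle: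
  fixes a b c d :: real
  assumes "0 \<le> a" "a \<le> b" "b \<le> 1" "0 \<le> c" "c \<le> d" "d \<le> 1"
  shows "measure uniform_point ({a..b} \<times> {c..d}) = (b - a) * (d - c)"
proof -
  have sub: "unit_square \<inter> ({a..b} \<times> {c..d}) = {a..b} \<times> {c..d}"
    using assms by (auto simp: unit_square_def)
  have "measure lborel ({a..b} \<times> {c..d}) = (b - a) * (d - c)"
    using assms by (simp add: measure_def emeasure_lborel_rectangle)
  moreover have "measure lborel unit_square = 1"
    by (simp add: measure_def emeasure_unit_square)
  ultimately show ?thesis
    by (subst measure_uniform_measure)
       (simp_all add: emeasure_unit_square sub closed_rectangle_eq_cbox[of a b c d, symmetric] del: measure_uniform_measure,
        simp add: closed_rectangle_eq_cbox)
qed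

text \<open>A point takes values in the whole plane, so samples outside the square exist. They form
  a null event, which the union bound for the upper estimate carries along.\<close>

lemma measure_uniform_point_outside: "measure uniform_point (- unit_square) = 0"
  by (subst measure_uniform_measure) (simp_all add: emeasure_unit_square borel_comp)

section \<open>The sample space and measurability of the graph\<close>

lemma finite_vertex_pairs [simp]: "finite (vertex_pairs n)"
  by (rule finite_subset[of _ "Pow {..<n}"]) (auto simp: vertex_pairs_def)

lemma prob_space_points_measure: "prob_space (points_measure n)"
  unfolding points_measure_def by (intro prob_space_PiM prob_space_uniform_point)

lemma prob_space_coins_measure: "prob_space (coins_measure n p)"
  unfolding coins_measure_def by (intro prob_space_PiM measure_pmf.prob_space_axioms)

lemma prob_space_random_graph_space: "prob_space (random_graph_space n p)"
  unfolding random_graph_space_def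
  by (intro prob_space_pair prob_space_points_measure prob_space_coins_measure)

lemma sets_points_measure [measurable_cong]:
  "sets (points_measure n) = sets (\<Pi>\<^sub>M i\<in>{..<n}. borel)"
  unfolding points_measure_def by (intro sets_PiM_cong) auto

lemma sets_coins_measure [measurable_cong]:
  "sets (coins_measure n p) = sets (\<Pi>\<^sub>M e\<in>vertex_pairs n. count_space UNIV)"
  unfolding coins_measure_def by (intro sets_PiM_cong) auto

lemma sets_random_graph_space [measurable_cong]:
  "sets (random_graph_space n p) = sets ((\<Pi>\<^sub>M i\<in>{..<n}. borel) \<Otimes>\<^sub>M (\<Pi>\<^sub>M e\<in>vertex_pairs n. count_space UNIV))"
  unfolding random_graph_space_def
  by (intro sets_pair_measure_cong sets_points_measure sets_coins_measure)

lemma measurable_point [measurable (raw)]: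
  "i < n \<Longrightarrow> (\<lambda>\<omega>. fst \<omega> i) \<in> borel_measurable (random_graph_space n p)"
  by measurable

lemma measurable_coin [measurable (raw)]:
  "e \<in> vertex_pairs n \<Longrightarrow> (\<lambda>\<omega>. snd \<omega> e) \<in> measurable (random_graph_space n p) (count_space UNIV)"
  by measurable

text \<open>The closed formula is available only inside the square, but the defining infimum runs
  over countably many translations and is measurable on the whole plane.\<close>

lemma measurable_torus_dist [measurable (raw)]:
  assumes [measurable]: "f \<in> borel_measurable M" "g \<in> borel_measurable M"
  shows "(\<lambda>x. torus_dist (f x) (g x)) \<in> borel_measurable M"
proof -
  have "(\<lambda>x. INF kl\<in>(UNIV :: (int \<times> int) set).
      dist (f x) (g x + (of_int (fst kl), of_int (snd kl)))) \<in> borel_measurable M"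
    by (rule borel_measurable_cINF_real) (auto intro!: borel_measurable_dist borel_measurable_add)
  then show ?thesis
    by (simp add: torus_dist_def case_prod_beta)
qed

lemma random_graph_subset: "random_graph n r \<omega> \<subseteq> vertex_pairs n"
  by (auto simp: random_graph_def coin_graph_def)

lemma mem_random_graph_iff:
  "e \<in> random_graph n r \<omega> \<longleftrightarrow> e \<in> vertex_pairs n \<and> snd \<omega> e \<and>
    (\<exists>i<n. \<exists>j<n. e = {i, j} \<and> i \<noteq> j \<and> torus_dist (fst \<omega> i) (fst \<omega> j) \<le> r)"
  by (auto simp: random_graph_def coin_graph_def geometric_graph_def)

text \<open>The graph has finitely many possible values, so it suffices that the presence of each
  single pair is an event. Every predicate of the graph, in particular one on its independence
  number, then defines an event.\<close>

lemma measurable_random_graph: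
  "random_graph n r \<in> measurable (random_graph_space n p) (count_space (Pow (vertex_pairs n)))"
proof (rule measurable_count_space_eq_countable[THEN iffD2])
  show "countable (Pow (vertex_pairs n))" by (simp add: countable_finite)
  have mem: "{\<omega> \<in> space (random_graph_space n p). e \<in> random_graph n r \<omega>}
      \<in> sets (random_graph_space n p)" if [measurable]: "e \<in> vertex_pairs n" for e
    unfolding mem_random_graph_iff by measurable
  show "random_graph n r \<in> space (random_graph_space n p) \<rightarrow> Pow (vertex_pairs n) \<and>
    (\<forall>a\<in>Pow (vertex_pairs n).
      random_graph n r -` {a} \<inter> space (random_graph_space n p) \<in> sets (random_graph_space n p))"
  proof (intro conjI ballI)
    fix a assume a: "a \<in> Pow (vertex_pairs n)"
    have "random_graph n r -` {a} \<inter> space (random_graph_space n p) =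
      {\<omega> \<in> space (random_graph_space n p). \<forall>e\<in>vertex_pairs n. e \<in> random_graph n r \<omega> \<longleftrightarrow> e \<in> a}"
      using a random_graph_subset[of n r] by blast
    also have "\<dots> \<in> sets (random_graph_space n p)"
    proof (intro sets.sets_Collect_finite_All finite_vertex_pairs)
      fix e assume e: "e \<in> vertex_pairs n"
      show "{\<omega> \<in> space (random_graph_space n p). e \<in> random_graph n r \<omega> \<longleftrightarrow> e \<in> a}
        \<in> sets (random_graph_space n p)"
        using mem[OF e] by (cases "e \<in> a") (auto intro: sets.sets_Collect_neg)
    qed
    finally show "random_graph n r -` {a} \<inter> space (random_graph_space n p)
      \<in> sets (random_graph_space n p)" .
  qed (use random_graph_subset in auto)
qed

lemma random_graph_event [measurable]:
  "{\<omega> \<in> space (random_graph_space n p). Q (random_graph n r \<omega>)} \<in> sets (random_graph_space n p)"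
proof -
  have "{\<omega> \<in> space (random_graph_space n p). Q (random_graph n r \<omega>)} =
    random_graph n r -` {G \<in> Pow (vertex_pairs n). Q G} \<inter> space (random_graph_space n p)"
    using random_graph_subset[of n r] by auto
  then show ?thesis
    using measurable_sets[OF measurable_random_graph, of "{G \<in> Pow (vertex_pairs n). Q G}" n r p]
    by auto
qed

lemma point_event:
  assumes "v < n" "A \<in> sets borel"
  shows "{\<omega> \<in> space (random_graph_space n p). fst \<omega> v \<in> A} \<in> sets (random_graph_space n p)"
  using measurable_sets[OF measurable_point assms(2), of v n p] assms(1)
  by (simp add: vimage_def Int_def conj_commute)

lemma coin_event:
  assumes "e \<in> vertex_pairs n"
  shows "{\<omega> \<in> space (random_graph_space n p). snd \<omega> e} \<in> sets (random_graph_space n p)"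
  using measurable_sets[OF measurable_coin[OF assms], of "{True}" p]
  by (simp add: vimage_def Int_def conj_commute)

section \<open>Probabilities of the bad events of both bounds\<close>

lemma event_points_in_and_no_coins:
  assumes S: "S \<subseteq> {..<n}" and F: "F \<subseteq> vertex_pairs n" and A: "A \<in> sets borel"
  shows "{\<omega> \<in> space (random_graph_space n p). (\<forall>v\<in>S. fst \<omega> v \<in> A) \<and> (\<forall>e\<in>F. \<not> snd \<omega> e)}
    \<in> sets (random_graph_space n p)"
  using S F A finite_subset[OF S] finite_subset[OF F]
  by (intro sets.sets_Collect_conj sets.sets_Collect_finite_All sets.sets_Collect_neg
      point_event coin_event) auto

text \<open>Points and coins are independent, so the event is a box in the product space;
  coordinates outside \<open>S\<close> and \<open>F\<close> are free and contribute the factor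
  1.\<close>

lemma prob_points_in_and_no_coins:
  assumes S: "S \<subseteq> {..<n}" and F: "F \<subseteq> vertex_pairs n" and A: "A \<in> sets borel"
    and p: "0 \<le> p" "p \<le> 1"
  shows "\<P>(\<omega> in random_graph_space n p. (\<forall>v\<in>S. fst \<omega> v \<in> A) \<and> (\<forall>e\<in>F. \<not> snd \<omega> e)) =
    measure uniform_point A ^ card S * (1 - p) ^ card F"
proof -
  interpret U: prob_space uniform_point by (rule prob_space_uniform_point)
  interpret P: product_prob_space "\<lambda>_::nat. uniform_point" "{..<n}"
    by (intro product_prob_spaceI prob_space_uniform_point)
  interpret P': finite_product_prob_space "\<lambda>_::nat. uniform_point" "{..<n}"
    by standard auto
  interpret C': finite_product_prob_space "\<lambda>_::nat set. coin p" "vertex_pairs n"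
    by standard auto
  interpret CM: prob_space "coins_measure n p" by (rule prob_space_coins_measure)
  define X where "X = (\<Pi>\<^sub>E i\<in>{..<n}. if i \<in> S then A else UNIV)"
  define B where "B = (\<Pi>\<^sub>E e\<in>vertex_pairs n. if e \<in> F then {False} else UNIV)"
  have eq: "{\<omega> \<in> space (random_graph_space n p). (\<forall>v\<in>S. fst \<omega> v \<in> A) \<and> (\<forall>e\<in>F. \<not> snd \<omega> e)} = X \<times> B"
  proof -
    have "x \<in> X \<longleftrightarrow> x \<in> space (points_measure n) \<and> (\<forall>v\<in>S. x v \<in> A)" for x
      using S unfolding X_def points_measure_def by (auto simp: space_PiM PiE_iff)
    moreover have "b \<in> B \<longleftrightarrow> b \<in> space (coins_measure n p) \<and> (\<forall>e\<in>F. \<not> b e)" for b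
      using F unfolding B_def coins_measure_def by (auto simp: space_PiM PiE_iff)
    ultimately show ?thesis
      by (auto simp: random_graph_space_def space_pair_measure)
  qed
  have "measure (points_measure n) X = (\<Prod>i<n. measure uniform_point (if i \<in> S then A else UNIV))"
    unfolding X_def points_measure_def using A by (intro P'.prob_times) auto
  also have "\<dots> = (\<Prod>i\<in>S. measure uniform_point A)"
    using S U.prob_space by (intro prod.mono_neutral_cong_right) auto
  finally have X: "measure (points_measure n) X = measure uniform_point A ^ card S"
    by simp
  have "measure (coins_measure n p) B = (\<Prod>e\<in>vertex_pairs n. measure (coin p) (if e \<in> F then {False} else UNIV))"
    unfolding B_def coins_measure_def by (intro C'.prob_times) auto
  also have "\<dots> = (\<Prod>e\<in>F. 1 - p)"
    using F p by (intro prod.mono_neutral_cong_right) (auto simp: measure_pmf_single)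
  finally have B: "measure (coins_measure n p) B = (1 - p) ^ card F"
    by simp
  have "X \<in> sets (points_measure n)" "B \<in> sets (coins_measure n p)"
    using A unfolding X_def B_def points_measure_def coins_measure_def
    by (intro sets_PiM_I_finite; simp)+
  then have "measure (random_graph_space n p) (X \<times> B) = measure (points_measure n) X * measure (coins_measure n p) B"
    unfolding random_graph_space_def
    by (simp add: measure_def CM.emeasure_pair_measure_Times enn2real_mult)
  then show ?thesis
    by (simp add: eq X B)
qed

lemma insert_mem_vertex_pairs:
  "u < n \<Longrightarrow> v < n \<Longrightarrow> u \<noteq> v \<Longrightarrow> {u, v} \<in> vertex_pairs n"
  by (auto simp: vertex_pairs_def)

text \<open>Distinct vertices of \<open>V\<close> use disjoint sets of coins towards
  \<open>I\<close>, so the events of having a coin edge into \<open>I\<close> are independent, and a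
  single vertex fails with probability \<open>(1 - p) ^ card I\<close>.\<close>

lemma prob_coins_dominated:
  assumes I: "I \<subseteq> {..<n}" and V: "V \<subseteq> {..<n}" "V \<inter> I = {}" and p: "0 \<le> p" "p \<le> 1"
  shows "\<P>(b in coins_measure n p. \<forall>v\<in>V. \<exists>u\<in>I. b {u, v}) = (1 - (1 - p) ^ card I) ^ card V"
proof (cases "V = {}")
  case True
  interpret CM: prob_space "coins_measure n p" by (rule prob_space_coins_measure)
  show ?thesis using True CM.prob_space by simp
next
  case False
  interpret CM: prob_space "coins_measure n p" by (rule prob_space_coins_measure)
  interpret C': finite_product_prob_space "\<lambda>_::nat set. coin p" "vertex_pairs n"
    by standard auto
  have fin: "finite I" "finite V" using I V by (auto intro: finite_subset)
  define K where "K v = (\<lambda>u. {u, v}) ` I" for v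
  have K: "K v \<subseteq> vertex_pairs n" if "v \<in> V" for v
    using that I V by (auto simp: K_def intro!: insert_mem_vertex_pairs)
  have finK: "finite (K v)" for v using fin by (simp add: K_def)
  have cardK: "card (K v) = card I" if "v \<in> V" for v
    unfolding K_def by (rule card_image) (auto simp: inj_on_def doubleton_eq_iff)
  \<comment> \<open>A pair shared by \<open>K v\<close> and \<open>K w\<close> with
    \<open>v \<noteq> w\<close> would be \<open>{v, w}\<close> and put \<open>v\<close> into
    \<open>I\<close>, against \<open>V \<inter> I = {}\<close>.\<close>
  have disj: "disjoint_family_on K V"
    using V unfolding disjoint_family_on_def K_def by (auto simp: doubleton_eq_iff)
  let ?N = "\<lambda>_::nat set. coin p"
  define E where "E v = {b \<in> space (coins_measure n p). \<exists>u\<in>I. b {u, v}}" for v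
  have coord: "(\<lambda>b. b e) \<in> measurable (coins_measure n p) (coin p)" if "e \<in> vertex_pairs n" for e
    unfolding coins_measure_def using that by (rule measurable_component_singleton)
  have "CM.indep_vars ?N (\<lambda>e b. b e) (vertex_pairs n)"
  proof (cases "vertex_pairs n = {}")
    case True
    then show ?thesis by (simp add: CM.indep_vars_def CM.indep_sets_def)
  next
    case False
    \<comment> \<open>The family of all coordinates is the identity of the product space, so its
      joint law is the product of the marginal laws.\<close>
    have "distr (coins_measure n p) (PiM (vertex_pairs n) ?N) (\<lambda>b. \<lambda>e\<in>vertex_pairs n. b e) =
      distr (coins_measure n p) (coins_measure n p) (\<lambda>b. b)"
      unfolding coins_measure_def
      by (intro distr_cong) (auto simp: space_PiM PiE_def extensional_restrict)
    also have "\<dots> = PiM (vertex_pairs n) (\<lambda>e. distr (coins_measure n p) (coin p) (\<lambda>b. b e))"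
      unfolding distr_id coins_measure_def
      by (intro PiM_cong refl C'.PiM_component[symmetric]) auto
    finally show ?thesis
      using False coord by (subst CM.indep_vars_iff_distr_eq_PiM') auto
  qed
  from CM.indep_vars_restrict[OF this K disj]
  have "CM.indep_vars (\<lambda>v. PiM (K v) ?N) (\<lambda>v b. restrict b (K v)) V"
    by simp
  then have "CM.indep_vars (\<lambda>_. count_space UNIV) (\<lambda>v b. \<exists>e\<in>K v. (restrict b (K v)) e) V"
  proof (rule CM.indep_vars_compose2)
    fix v assume "v \<in> V"
    show "(\<lambda>b. \<exists>e\<in>K v. b e) \<in> measurable (PiM (K v) ?N) (count_space UNIV)"
    proof (intro pred_intros_finite finK)
      fix e assume [measurable]: "e \<in> K v"
      show "(\<lambda>b. b e) \<in> measurable (PiM (K v) ?N) (count_space UNIV)"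
        by measurable
    qed
  qed
  then have "CM.indep_vars (\<lambda>_. count_space UNIV) (\<lambda>v b. \<exists>u\<in>I. b {u, v}) V"
    by (simp add: K_def)
  from CM.indep_varsD_finite[OF this False fin(2), of "\<lambda>_. {True}"]
  have "measure (coins_measure n p) (\<Inter>v\<in>V. E v) = (\<Prod>v\<in>V. measure (coins_measure n p) (E v))"
    by (simp add: E_def vimage_def Int_def conj_commute)
  moreover have "measure (coins_measure n p) (E v) = 1 - (1 - p) ^ card I" if v: "v \<in> V" for v
  proof -
    define B where "B = (\<Pi>\<^sub>E e\<in>vertex_pairs n. if e \<in> K v then {False} else UNIV)"
    have Bm: "B \<in> sets (coins_measure n p)"
      unfolding B_def coins_measure_def by (intro sets_PiM_I_finite; simp)
    have "measure (coins_measure n p) B = (\<Prod>e\<in>vertex_pairs n. measure (coin p) (if e \<in> K v then {False} else UNIV))"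
      unfolding B_def coins_measure_def by (intro C'.prob_times) auto
    also have "\<dots> = (\<Prod>e\<in>K v. 1 - p)"
      using K[OF v] p by (intro prod.mono_neutral_cong_right) (auto simp: measure_pmf_single)
    finally have "measure (coins_measure n p) B = (1 - p) ^ card I"
      by (simp add: cardK v)
    moreover have "b \<in> B \<longleftrightarrow> b \<in> space (coins_measure n p) \<and> (\<forall>e\<in>K v. \<not> b e)" for b
      using K[OF v] unfolding B_def coins_measure_def by (auto simp: space_PiM PiE_iff)
    then have "E v = space (coins_measure n p) - B"
      by (auto simp: E_def K_def)
    ultimately show ?thesis
      using CM.prob_compl[OF Bm] by simp
  qed
  moreover have "(\<Inter>v\<in>V. E v) = {b \<in> space (coins_measure n p). \<forall>v\<in>V. \<exists>u\<in>I. b {u, v}}"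
    using False by (auto simp: E_def)
  ultimately show ?thesis by simp
qed

lemma event_cell_dominated:
  assumes I: "I \<subseteq> {..<n}" and A: "A \<in> sets borel"
  shows "{\<omega> \<in> space (random_graph_space n p).
      \<forall>v\<in>{..<n} - I. fst \<omega> v \<in> A \<longrightarrow> (\<exists>u\<in>I. snd \<omega> {u, v})} \<in> sets (random_graph_space n p)"
  using I A finite_subset[OF I]
  by (intro sets.sets_Collect_finite_All sets.sets_Collect_imp sets.sets_Collect_finite_Ex
      point_event coin_event insert_mem_vertex_pairs) auto

text \<open>Fubini: with the points fixed, the coins succeed with probability
  \<open>(1 - q) ^ card V\<close>, where \<open>q = (1 - p) ^ card I\<close> and \<open>V\<close> is
  the set of vertices outside \<open>I\<close> whose point is in \<open>A\<close>. This is a product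
  of functions of single points, so the integral over the points factorizes.\<close>

lemma prob_cell_dominated:
  assumes I: "I \<subseteq> {..<n}" and A: "A \<in> sets borel" and p: "0 \<le> p" "p \<le> 1"
  shows "\<P>(\<omega> in random_graph_space n p.
      \<forall>v\<in>{..<n} - I. fst \<omega> v \<in> A \<longrightarrow> (\<exists>u\<in>I. snd \<omega> {u, v})) =
    (1 - measure uniform_point A * (1 - p) ^ card I) ^ (n - card I)"
proof -
  interpret U: prob_space uniform_point by (rule prob_space_uniform_point)
  interpret P: product_sigma_finite "\<lambda>_::nat. uniform_point"
    by (intro product_sigma_finite.intro) (simp add: U.sigma_finite_measure_axioms)
  interpret CM: prob_space "coins_measure n p" by (rule prob_space_coins_measure)
  interpret M: prob_space "random_graph_space n p" by (rule prob_space_random_graph_space)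
  define a where "a = measure uniform_point A"
  define q where "q = (1 - p) ^ card I"
  have q: "0 \<le> q" "q \<le> 1" using p by (auto simp: q_def power_le_one)
  have a: "0 \<le> a" "a \<le> 1" by (auto simp: a_def U.prob_le_1)
  define W where "W = {\<omega> \<in> space (random_graph_space n p).
      \<forall>v\<in>{..<n} - I. fst \<omega> v \<in> A \<longrightarrow> (\<exists>u\<in>I. snd \<omega> {u, v})}"
  have finI: "finite I" using I by (auto intro: finite_subset)
  have Wm: "W \<in> sets (random_graph_space n p)"
    unfolding W_def using I A by (rule event_cell_dominated)
  have fiber: "emeasure (coins_measure n p) (Pair x -` W) =
      (\<Prod>v\<in>{..<n}. ennreal (if v \<in> I then 1 else 1 - q * indicator A (x v)))"
    if x: "x \<in> space (points_measure n)" for x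
  proof -
    define V where "V = {v \<in> {..<n} - I. x v \<in> A}"
    have "Pair x -` W = {b \<in> space (coins_measure n p). \<forall>v\<in>V. \<exists>u\<in>I. b {u, v}}"
      using x by (auto simp: W_def V_def random_graph_space_def space_pair_measure)
    then have "emeasure (coins_measure n p) (Pair x -` W) = ennreal ((1 - q) ^ card V)"
      unfolding CM.emeasure_eq_measure q_def
      by (subst prob_coins_dominated[symmetric, OF I _ _ p]) (auto simp: V_def)
    also have "(1 - q) ^ card V = (\<Prod>v\<in>V. 1 - q)"
      by simp
    also have "\<dots> = (\<Prod>v\<in>{..<n}. if v \<in> I then 1 else 1 - q * indicator A (x v))"
      by (intro prod.mono_neutral_cong_left) (auto simp: V_def indicator_def)
    also have "ennreal \<dots> = (\<Prod>v\<in>{..<n}. ennreal (if v \<in> I then 1 else 1 - q * indicator A (x v)))"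
      using q by (intro prod_ennreal[symmetric]) (auto simp: indicator_def)
    finally show ?thesis .
  qed
  have single: "(\<integral>\<^sup>+ y. ennreal (if v \<in> I then 1 else 1 - q * indicator A y) \<partial>uniform_point) =
      ennreal (if v \<in> I then 1 else 1 - a * q)" for v
  proof (cases "v \<in> I")
    case False
    have "(\<integral>\<^sup>+ y. ennreal (1 - q * indicator A y) \<partial>uniform_point) =
        ennreal (\<integral> y. 1 - q * indicator A y \<partial>uniform_point)"
      using A q
      by (intro nn_integral_eq_integral AE_I2 U.integrable_const_bound[where B = 1])
         (auto simp: indicator_def)
    also have "(\<integral> y. 1 - q * indicator A y \<partial>uniform_point) = 1 - q * a"
      using A U.prob_space unfolding a_def
      by (subst Bochner_Integration.integral_diff)
         (auto simp: U.emeasure_eq_measure intro!: integrable_mult_right integrable_real_indicator)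
    finally show ?thesis using False by (simp add: mult.commute)
  qed (use U.emeasure_space_1 in \<open>simp del: emeasure_uniform_measure\<close>)
  have "emeasure (random_graph_space n p) W =
      (\<integral>\<^sup>+ x. emeasure (coins_measure n p) (Pair x -` W) \<partial>points_measure n)"
    using Wm unfolding random_graph_space_def by (rule CM.emeasure_pair_measure_alt)
  also have "\<dots> = (\<integral>\<^sup>+ x. (\<Prod>v\<in>{..<n}. ennreal (if v \<in> I then 1 else 1 - q * indicator A (x v))) \<partial>points_measure n)"
    by (intro nn_integral_cong fiber)
  also have "\<dots> = (\<Prod>v\<in>{..<n}. \<integral>\<^sup>+ y. ennreal (if v \<in> I then 1 else 1 - q * indicator A y) \<partial>uniform_point)"
    unfolding points_measure_def using A
    by (intro P.product_nn_integral_prod) auto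
  also have "\<dots> = (\<Prod>v\<in>{..<n}. ennreal (if v \<in> I then 1 else 1 - a * q))"
    by (simp only: single)
  also have "\<dots> = ennreal (\<Prod>v\<in>{..<n}. if v \<in> I then 1 else 1 - a * q)"
    using a q by (intro prod_ennreal) (auto intro: mult_le_one)
  also have "(\<Prod>v\<in>{..<n}. if v \<in> I then 1 else 1 - a * q) = (\<Prod>v\<in>{..<n} - I. 1 - a * q)"
    by (intro prod.mono_neutral_cong_right) auto
  also have "\<dots> = (1 - a * q) ^ (n - card I)"
    using I finI by (simp add: card_Diff_subset)
  finally have "measure (random_graph_space n p) W = (1 - a * q) ^ (n - card I)"
    using a q by (simp add: measure_def mult_le_one)
  then show ?thesis
    by (simp add: W_def a_def q_def)
qed

subsection \<open>Independent sets and grid cells\<close>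

lemma finite_independent_cards: "finite V \<Longrightarrow> finite {card S |S. independent_set V E S}"
  by (rule finite_subset[of _ "card ` Pow V"]) (auto simp: independent_set_def)

lemma card_le_independence_number:
  "finite V \<Longrightarrow> independent_set V E S \<Longrightarrow> card S \<le> independence_number V E"
  unfolding independence_number_def by (rule Max_ge) (auto intro: finite_independent_cards)

lemma independence_number_attained:
  assumes "finite V"
  obtains S where "independent_set V E S" "card S = independence_number V E"
proof -
  have "independent_set V E {}" by (simp add: independent_set_def)
  then have "independence_number V E \<in> {card S |S. independent_set V E S}"
    unfolding independence_number_def using finite_independent_cards[OF assms]
    by (intro Max_in) auto
  then show ?thesis using that by auto
qed

text \<open>An edge is an unordered pair and may be read in either order; assuming both inequalities
  replaces an appeal to the symmetry of \<open>torus_dist\<close>.\<close>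

lemma not_edge_random_graph:
  assumes "r < torus_dist (X u) (X v)" "r < torus_dist (X v) (X u)"
  shows "{u, v} \<notin> random_graph n r (X, B)"
  using assms by (fastforce simp: random_graph_def geometric_graph_def doubleton_eq_iff)

section \<open>The grid of cells on the torus\<close>

definition grid_cell :: "nat \<Rightarrow> nat \<times> nat \<Rightarrow> (real \<times> real) set" where
  "grid_cell m c = {real (fst c) / m..(real (fst c) + 1) / m} \<times> {real (snd c) / m..(real (snd c) + 1) / m}"

text \<open>The lower left quarter of a grid cell. The strips left out keep different half cells at
  torus distance at least \<open>1 / (2 * m)\<close>.\<close>

definition half_cell :: "nat \<Rightarrow> nat \<times> nat \<Rightarrow> (real \<times> real) set" where
  "half_cell m c = {real (fst c) / m..(real (fst c) + 1 / 2) / m} \<times> {real (snd c) / m..(real (snd c) + 1 / 2) / m}"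

lemma unit_interval_cells:
  fixes t :: real
  assumes "0 < m" "0 \<le> t" "t \<le> 1"
  obtains i where "i < m" "real i / m \<le> t" "t \<le> (real i + 1) / m"
proof (cases "t = 1")
  \<comment> \<open>The floor of \<open>t * m\<close> would be \<open>m\<close> here, beyond the
    last index; the closed last cell contains the end point.\<close>
  case True
  then show ?thesis using that[of "m - 1"] assms by (simp add: of_nat_diff)
next
  case False
  have "nat \<lfloor>t * m\<rfloor> < m"
    using assms False by (simp add: nat_less_iff floor_less_iff)
  moreover have "real (nat \<lfloor>t * m\<rfloor>) \<le> t * m" "t * m \<le> real (nat \<lfloor>t * m\<rfloor>) + 1"
    using assms by auto
  ultimately show ?thesis
    using that[of "nat \<lfloor>t * m\<rfloor>"] assms by (simp add: field_simps)
qed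

lemma unit_square_cells:
  assumes "0 < m" "x \<in> unit_square"
  obtains c where "c \<in> {..<m} \<times> {..<m}" "x \<in> grid_cell m c"
proof -
  have x: "0 \<le> fst x" "fst x \<le> 1" "0 \<le> snd x" "snd x \<le> 1"
    using assms by (auto simp: unit_square_def)
  obtain i where "i < m" "real i / m \<le> fst x" "fst x \<le> (real i + 1) / m"
    using unit_interval_cells assms(1) x by blast
  moreover obtain j where "j < m" "real j / m \<le> snd x" "snd x \<le> (real j + 1) / m"
    using unit_interval_cells assms(1) x by blast
  ultimately show ?thesis
    using that[of "(i, j)"] by (cases x) (auto simp: grid_cell_def)
qed

lemma torus_dist_grid_cell:
  assumes "x \<in> grid_cell m c" "y \<in> grid_cell m c" "x \<in> unit_square" "y \<in> unit_square"
  shows "torus_dist x y \<le> sqrt 2 / m"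
proof -
  let ?a = "fst x - fst y" and ?b = "snd x - snd y"
  have b: "\<bar>?a\<bar> \<le> 1 / m" "\<bar>?b\<bar> \<le> 1 / m" "\<bar>?a\<bar> \<le> 1" "\<bar>?b\<bar> \<le> 1"
    using assms by (auto simp: grid_cell_def unit_square_def add_divide_distrib)
  have "torus_dist x y \<le> sqrt ((1 / m)\<^sup>2 + (1 / m)\<^sup>2)"
    unfolding torus_dist_unit_square[OF assms(3,4)] using b
    by (intro real_sqrt_le_mono add_mono power_mono) auto
  also have "\<dots> = sqrt 2 / m"
    by (simp add: power_divide real_sqrt_divide flip: add_divide_distrib)
  finally show ?thesis .
qed

lemma half_cell_subset_unit_square:
  assumes "c \<in> {..<m} \<times> {..<m}"
  shows "half_cell m c \<subseteq> unit_square"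
proof -
  have "real (fst c) + 1 \<le> m" "real (snd c) + 1 \<le> m"
    using assms by auto
  then have "0 < m" "(real (fst c) + 1 / 2) / m \<le> 1" "(real (snd c) + 1 / 2) / m \<le> 1"
    by (auto simp: field_simps)
  moreover have "0 \<le> real (fst c) / m" "0 \<le> real (snd c) / m" by simp_all
  ultimately show ?thesis
    unfolding half_cell_def unit_square_def
    by (intro Sigma_mono) (auto intro: order_trans)
qed

lemma circle_dist_half_cells:
  fixes s t :: real
  assumes ij: "i < m" "j < m" "i \<noteq> j"
    and s: "real i / m \<le> s" "s \<le> (real i + 1 / 2) / m"
    and t: "real j / m \<le> t" "t \<le> (real j + 1 / 2) / m"
  shows "1 / (2 * real m) \<le> min \<bar>s - t\<bar> (1 - \<bar>s - t\<bar>)"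
proof -
  \<comment> \<open>The first bound is the direct gap; the second leaves the same length for the way
    round the circle, because the last half cell ends \<open>1 / (2 * m)\<close> before 1.\<close>
  have gap: "1 / (2 * real m) \<le> v - u" "v - u \<le> 1 - 1 / (2 * real m)"
    if "k < l" "l < m" "real k / m \<le> u" "u \<le> (real k + 1 / 2) / m"
      "real l / m \<le> v" "v \<le> (real l + 1 / 2) / m" for k l and u v :: real
  proof -
    have m: "0 < real m" using that by simp
    have kl: "real k + 1 \<le> real l" "real l + 1 \<le> real m" "0 \<le> real k" using that by auto
    have u: "real k \<le> u * m" "u * m \<le> real k + 1 / 2" and v: "real l \<le> v * m" "v * m \<le> real l + 1 / 2"
      using that m by (simp_all add: field_simps)
    have "1 / 2 \<le> (v - u) * m" "(v - u) * m \<le> m - 1 / 2"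
      using u v kl by (auto simp: algebra_simps)
    then show "1 / (2 * real m) \<le> v - u" "v - u \<le> 1 - 1 / (2 * real m)"
      using m by (simp_all add: field_simps)
  qed
  from ij consider "i < j" | "j < i" by linarith
  then show ?thesis
  proof cases
    case 1
    from gap[OF 1 ij(2) s t] show ?thesis by auto
  next
    case 2
    from gap[OF 2 ij(1) t s] show ?thesis by auto
  qed
qed

lemma torus_dist_half_cells:
  assumes c: "c \<in> {..<m} \<times> {..<m}" and d: "d \<in> {..<m} \<times> {..<m}" and "c \<noteq> d"
    and x: "x \<in> half_cell m c" and y: "y \<in> half_cell m d"
  shows "1 / (2 * real m) \<le> torus_dist x y"
proof -
  have us: "x \<in> unit_square" "y \<in> unit_square"
    using half_cell_subset_unit_square[OF c] half_cell_subset_unit_square[OF d] x y by auto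
  let ?A = "min \<bar>fst x - fst y\<bar> (1 - \<bar>fst x - fst y\<bar>)"
  let ?B = "min \<bar>snd x - snd y\<bar> (1 - \<bar>snd x - snd y\<bar>)"
  have "1 / (2 * real m) \<le> ?A \<or> 1 / (2 * real m) \<le> ?B"
  proof (cases "fst c = fst d")
    case False
    then show ?thesis
      using c d x y by (intro disjI1 circle_dist_half_cells[of "fst c" _ "fst d"])
        (auto simp: half_cell_def)
  next
    case True
    then have "snd c \<noteq> snd d" using \<open>c \<noteq> d\<close> by (auto simp: prod_eq_iff)
    then show ?thesis
      using c d x y by (intro disjI2 circle_dist_half_cells[of "snd c" _ "snd d"])
        (auto simp: half_cell_def)
  qed
  moreover have "?A \<le> sqrt (?A\<^sup>2 + ?B\<^sup>2)" "?B \<le> sqrt (?A\<^sup>2 + ?B\<^sup>2)"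
    by (rule real_le_rsqrt; simp)+
  ultimately show ?thesis
    unfolding torus_dist_unit_square[OF us] by linarith
qed

text \<open>Deterministic half of the upper bound, by pigeonhole: of more than
  \<open>m\<^sup>2 * k\<close> independent vertices, \<open>Suc k\<close> share a cell. The cell has
  diameter at most \<open>r\<close>, so the coin pair supplied by \<open>cells\<close> is an edge of
  the graph.\<close>

lemma independence_number_le_grid:
  assumes m: "0 < m" "sqrt 2 / m \<le> r"
    and X: "\<And>v. v < n \<Longrightarrow> X v \<in> unit_square"
    and cells: "\<And>S c. S \<subseteq> {..<n} \<Longrightarrow> card S = Suc k \<Longrightarrow> c \<in> {..<m} \<times> {..<m} \<Longrightarrow>
      \<forall>v\<in>S. X v \<in> grid_cell m c \<Longrightarrow> \<exists>e. e \<subseteq> S \<and> card e = 2 \<and> B e"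
  shows "independence_number {..<n} (random_graph n r (X, B)) \<le> m\<^sup>2 * k"
proof (rule ccontr)
  assume less: "\<not> ?thesis"
  obtain T where T: "independent_set {..<n} (random_graph n r (X, B)) T"
    "card T = independence_number {..<n} (random_graph n r (X, B))"
    using independence_number_attained finite_lessThan by blast
  have Tn: "T \<subseteq> {..<n}" using T by (simp add: independent_set_def)
  then have finT: "finite T" by (auto intro: finite_subset)
  have "\<forall>v\<in>T. \<exists>c\<in>{..<m} \<times> {..<m}. X v \<in> grid_cell m c"
  proof
    fix v assume "v \<in> T"
    then have "X v \<in> unit_square" using X Tn by auto
    then show "\<exists>c\<in>{..<m} \<times> {..<m}. X v \<in> grid_cell m c"
      by (rule unit_square_cells[OF m(1)]) blast
  qed
  \<comment> \<open>Closed cells overlap along their sides; \<open>cell\<close> fixes one cell for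
    each vertex.\<close>
  then obtain cell where cell: "\<And>v. v \<in> T \<Longrightarrow> cell v \<in> {..<m} \<times> {..<m}"
    "\<And>v. v \<in> T \<Longrightarrow> X v \<in> grid_cell m (cell v)"
    by metis
  have "\<exists>c\<in>{..<m} \<times> {..<m}. k < card {v \<in> T. cell v = c}"
  proof (rule ccontr)
    assume "\<not> ?thesis"
    then have le: "card {v \<in> T. cell v = c} \<le> k" if "c \<in> {..<m} \<times> {..<m}" for c
      using that not_less by blast
    have "T = (\<Union>c\<in>{..<m} \<times> {..<m}. {v \<in> T. cell v = c})"
      using cell by auto
    then have "card T = card (\<Union>c\<in>{..<m} \<times> {..<m}. {v \<in> T. cell v = c})"
      by (rule arg_cong)
    also have "\<dots> \<le> (\<Sum>c\<in>{..<m} \<times> {..<m}. card {v \<in> T. cell v = c})"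
      by (rule card_UN_le) simp
    also have "\<dots> \<le> card ({..<m} \<times> {..<m}) * k"
      using le by (rule sum_bounded_above[where K = k, simplified])
    finally show False using less T by (simp add: power2_eq_square)
  qed
  then obtain c where c: "c \<in> {..<m} \<times> {..<m}" "k < card {v \<in> T. cell v = c}" by (rule bexE)
  then obtain S where S: "S \<subseteq> {v \<in> T. cell v = c}" "card S = Suc k"
    using obtain_subset_with_card_n[of "Suc k" "{v \<in> T. cell v = c}"] by (auto simp: Suc_le_eq)
  have Sn: "S \<subseteq> {..<n}" and SX: "\<forall>v\<in>S. X v \<in> grid_cell m c"
    using S Tn cell by auto
  obtain e where e: "e \<subseteq> S" "card e = 2" "B e"
    using cells[OF Sn S(2) c(1) SX] by blast
  then obtain u v where uv: "e = {u, v}" "u \<noteq> v" by (auto simp: card_2_iff)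
  have uS: "u \<in> S" "v \<in> S" using e uv by auto
  have "torus_dist (X u) (X v) \<le> sqrt 2 / m"
    using SX uS X Sn by (intro torus_dist_grid_cell[of _ _ c]) auto
  then have "torus_dist (X u) (X v) \<le> r" using m by linarith
  moreover have "u < n" "v < n" using uS Sn by auto
  ultimately have "{u, v} \<in> random_graph n r (X, B)"
    using uv e by (auto simp: random_graph_def geometric_graph_def coin_graph_def vertex_pairs_def)
  moreover have "u \<in> T" "v \<in> T" using uS S by auto
  ultimately show False using T by (auto simp: independent_set_def)
qed

text \<open>Deterministic half of the lower bound. A maximum coin-independent set of a cell with
  fewer than \<open>k\<close> elements could be enlarged by the vertex that \<open>cells\<close>
  supplies. The bound on \<open>m\<close> makes the separation \<open>1 / (2 * m)\<close> exceed
  \<open>r\<close>, so the union over all cells stays independent; for \<open>m = 1\<close> there is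
  only one cell.\<close>

lemma independence_number_ge_grid:
  assumes m: "m = 1 \<or> 2 * real m * r < 1" and r: "0 < r"
    and cells: "\<And>I c. I \<subseteq> {..<n} \<Longrightarrow> card I < k \<Longrightarrow> c \<in> {..<m} \<times> {..<m} \<Longrightarrow>
      \<exists>v\<in>{..<n} - I. X v \<in> half_cell m c \<and> (\<forall>u\<in>I. \<not> B {u, v})"
  shows "m\<^sup>2 * k \<le> independence_number {..<n} (random_graph n r (X, B))"
proof -
  define V where "V c = {v. v < n \<and> X v \<in> half_cell m c}" for c
  have finV: "finite (V c)" for c by (simp add: V_def)
  have far: "r < torus_dist x y" if "c \<in> {..<m} \<times> {..<m}" "d \<in> {..<m} \<times> {..<m}" "c \<noteq> d"
    "x \<in> half_cell m c" "y \<in> half_cell m d" for c d x y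
  proof -
    have "m \<noteq> 1" using that by (auto simp: prod_eq_iff)
    moreover have "0 < m" using that by auto
    ultimately have "r < 1 / (2 * real m)" using m by (simp add: field_simps)
    then show ?thesis using torus_dist_half_cells[OF that] by linarith
  qed
  have "\<exists>I. independent_set (V c) (coin_graph n B) I \<and> k \<le> card I"
    if c: "c \<in> {..<m} \<times> {..<m}" for c
  proof -
    obtain I where I: "independent_set (V c) (coin_graph n B) I"
      "card I = independence_number (V c) (coin_graph n B)"
      using independence_number_attained finV by blast
    have IV: "I \<subseteq> V c" using I by (simp add: independent_set_def)
    have "k \<le> card I"
    proof (rule ccontr)
      assume "\<not> k \<le> card I"
      then obtain v where v: "v \<in> {..<n} - I" "X v \<in> half_cell m c" "\<forall>u\<in>I. \<not> B {u, v}"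
        using cells[of I c] c IV by (auto simp: V_def)
      \<comment> \<open>The case of two equal vertices is harmless, as a singleton never belongs to
        \<open>coin_graph\<close>.\<close>
      have "independent_set (V c) (coin_graph n B) (insert v I)"
        using I v by (auto simp: independent_set_def coin_graph_def V_def vertex_pairs_def insert_commute)
      from card_le_independence_number[OF finV this] show False
        using I v IV finV[of c] by (simp add: card_insert_disjoint finite_subset)
    qed
    then show ?thesis using I by blast
  qed
  then obtain I where I: "\<And>c. c \<in> {..<m} \<times> {..<m} \<Longrightarrow> independent_set (V c) (coin_graph n B) (I c)"
    "\<And>c. c \<in> {..<m} \<times> {..<m} \<Longrightarrow> k \<le> card (I c)"
    by metis
  have IV: "I c \<subseteq> V c" if "c \<in> {..<m} \<times> {..<m}" for c
    using I(1)[OF that] by (simp add: independent_set_def)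
  define S where "S = (\<Union>c\<in>{..<m} \<times> {..<m}. I c)"
  have "independent_set {..<n} (random_graph n r (X, B)) S"
    unfolding independent_set_def
  proof (intro conjI ballI)
    show "S \<subseteq> {..<n}" using IV by (fastforce simp: S_def V_def)
    fix u v assume "u \<in> S" "v \<in> S"
    then obtain c d where cd: "c \<in> {..<m} \<times> {..<m}" "u \<in> I c" "d \<in> {..<m} \<times> {..<m}" "v \<in> I d"
      unfolding S_def by blast
    show "{u, v} \<notin> random_graph n r (X, B)"
    proof (cases "c = d")
      case True
      then have "{u, v} \<notin> coin_graph n B"
        using I(1)[OF cd(1)] cd by (auto simp: independent_set_def)
      then show ?thesis by (simp add: random_graph_def)
    next
      case False
      have "X u \<in> half_cell m c" "X v \<in> half_cell m d"
        using IV cd by (auto simp: V_def)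
      then show ?thesis
        using far False cd by (intro not_edge_random_graph) metis+
    qed
  qed
  from card_le_independence_number[OF _ this]
  have "card S \<le> independence_number {..<n} (random_graph n r (X, B))" by simp
  moreover have "card S = (\<Sum>c\<in>{..<m} \<times> {..<m}. card (I c))"
    unfolding S_def
  proof (rule card_UN_disjoint)
    show "\<forall>c\<in>{..<m} \<times> {..<m}. finite (I c)" using IV finV finite_subset by metis
    show "\<forall>c\<in>{..<m} \<times> {..<m}. \<forall>d\<in>{..<m} \<times> {..<m}. c \<noteq> d \<longrightarrow> I c \<inter> I d = {}"
    proof (intro ballI impI equals0I)
      \<comment> \<open>A vertex in two cells would be at distance more than \<open>r > 0\<close>
        from itself.\<close>
      fix c d v assume cd: "c \<in> {..<m} \<times> {..<m}" "d \<in> {..<m} \<times> {..<m}" "c \<noteq> d" "v \<in> I c \<inter> I d"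
      then have v: "X v \<in> half_cell m c" "X v \<in> half_cell m d" using IV by (auto simp: V_def)
      then have "X v \<in> unit_square" using half_cell_subset_unit_square cd by blast
      then have "torus_dist (X v) (X v) = 0" by (simp add: torus_dist_unit_square)
      then show False using far[OF cd(1-3) v] r by simp
    qed
  qed simp
  moreover have "m\<^sup>2 * k \<le> (\<Sum>c\<in>{..<m} \<times> {..<m}. card (I c))"
    using sum_bounded_below[of "{..<m} \<times> {..<m}" k "\<lambda>c. card (I c)"] I(2)
    by (simp add: power2_eq_square)
  ultimately show ?thesis by simp
qed

subsection \<open>Union bounds\<close>

lemma grid_cell_borel: "grid_cell m c \<in> sets borel"
  by (simp add: grid_cell_def closed_rectangle_eq_cbox)

lemma half_cell_borel: "half_cell m c \<in> sets borel"
  by (simp add: half_cell_def closed_rectangle_eq_cbox)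

lemma measure_uniform_point_grid_cell:
  assumes "c \<in> {..<m} \<times> {..<m}"
  shows "measure uniform_point (grid_cell m c) = 1 / m\<^sup>2"
proof -
  have c: "real (fst c) + 1 \<le> m" "real (snd c) + 1 \<le> m"
    using assms by auto
  then have "0 < real m" by linarith
  then show ?thesis
    unfolding grid_cell_def using c
    by (subst measure_uniform_point_rectangle) (auto simp: field_simps power2_eq_square)
qed

lemma measure_uniform_point_half_cell:
  assumes "c \<in> {..<m} \<times> {..<m}"
  shows "measure uniform_point (half_cell m c) = 1 / (4 * m\<^sup>2)"
proof -
  have c: "real (fst c) + 1 \<le> m" "real (snd c) + 1 \<le> m"
    using assms by auto
  then have "0 < real m" by linarith
  then show ?thesis
    unfolding half_cell_def using c
    by (subst measure_uniform_point_rectangle) (auto simp: field_simps power2_eq_square)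
qed

lemma binomial_le_power: "n choose k \<le> n ^ k"
  by (cases "k \<le> n") (auto simp: binomial_le_pow binomial_eq_0)

lemma card_small_subsets_le:
  assumes "1 \<le> n"
  shows "card {I. I \<subseteq> {..<n} \<and> card I \<le> k} \<le> Suc k * n ^ k"
proof -
  have "{I. I \<subseteq> {..<n} \<and> card I \<le> k} = (\<Union>j\<in>{..k}. {I. I \<subseteq> {..<n} \<and> card I = j})"
    by auto
  then have "card {I. I \<subseteq> {..<n} \<and> card I \<le> k} = card (\<Union>j\<in>{..k}. {I. I \<subseteq> {..<n} \<and> card I = j})"
    by (rule arg_cong)
  also have "\<dots> \<le> (\<Sum>j\<in>{..k}. card {I. I \<subseteq> {..<n} \<and> card I = j})"
    by (rule card_UN_le) simp
  also have "\<dots> \<le> (\<Sum>j\<in>{..k}. n ^ k)"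
  proof (intro sum_mono)
    fix j assume "j \<in> {..k}"
    have "card {I. I \<subseteq> {..<n} \<and> card I = j} = n choose j"
      using n_subsets[of "{..<n}" j] by simp
    also have "\<dots> \<le> n ^ j" by (rule binomial_le_power)
    also have "\<dots> \<le> n ^ k" using assms \<open>j \<in> {..k}\<close> by (intro power_increasing) auto
    finally show "card {I. I \<subseteq> {..<n} \<and> card I = j} \<le> n ^ k" .
  qed
  also have "\<dots> = Suc k * n ^ k" by simp
  finally show ?thesis .
qed

text \<open>First-moment bound over at most \<open>n ^ Suc k\<close> vertex sets and
  \<open>m\<^sup>2\<close> cells: a fixed set falls into a fixed cell with probability
  \<open>(1 / m\<^sup>2) ^ Suc k\<close>, and independently its \<open>Suc k choose 2\<close> coins
  all fail.\<close>

lemma prob_independence_number_gt: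
  assumes m: "0 < m" "sqrt 2 / m \<le> r" and p: "0 \<le> p" "p \<le> 1"
  shows "\<P>(\<omega> in random_graph_space n p.
      m\<^sup>2 * k < independence_number {..<n} (random_graph n r \<omega>))
    \<le> real (m\<^sup>2) * (real n / (real m)\<^sup>2) ^ Suc k * (1 - p) ^ (Suc k choose 2)"
proof -
  interpret M: prob_space "random_graph_space n p" by (rule prob_space_random_graph_space)
  let ?M = "random_graph_space n p"
  define cells where "cells = {..<m} \<times> {..<m}"
  define subsets where "subsets = {S. S \<subseteq> {..<n} \<and> card S = Suc k}"
  \<comment> \<open>The singleton and the empty coin set cast the event into the form of
    \<open>prob_points_in_and_no_coins\<close>.\<close>
  define out where "out v = {\<omega> \<in> space ?M. (\<forall>u\<in>{v}. fst \<omega> u \<in> - unit_square) \<and> (\<forall>e\<in>{}. \<not> snd \<omega> e)}" for v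
  define bad where "bad Sc = {\<omega> \<in> space ?M. (\<forall>v\<in>fst Sc. fst \<omega> v \<in> grid_cell m (snd Sc)) \<and>
      (\<forall>e\<in>{e. e \<subseteq> fst Sc \<and> card e = 2}. \<not> snd \<omega> e)}" for Sc
  have fin: "finite (subsets \<times> cells)" by (simp add: subsets_def cells_def)
  have pairs: "{e. e \<subseteq> S \<and> card e = 2} \<subseteq> vertex_pairs n" if "S \<in> subsets" for S
    using that by (auto simp: subsets_def vertex_pairs_def)
  have out: "out v \<in> sets ?M" "measure ?M (out v) = 0" if "v \<in> {..<n}" for v
  proof -
    have v: "{v} \<subseteq> {..<n}" using that by simp
    have b: "- unit_square \<in> sets borel" by (intro borel_comp unit_square_borel)
    show "out v \<in> sets ?M"
      unfolding out_def by (rule event_points_in_and_no_coins[OF v _ b]) simp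
    show "measure ?M (out v) = 0"
      unfolding out_def
      by (subst prob_points_in_and_no_coins[OF v _ b p]) (simp_all only: measure_uniform_point_outside, simp_all)
  qed
  have bad: "bad Sc \<in> sets ?M"
    "measure ?M (bad Sc) = (1 / m\<^sup>2) ^ Suc k * (1 - p) ^ (Suc k choose 2)"
    if "Sc \<in> subsets \<times> cells" for Sc
  proof -
    have S: "fst Sc \<subseteq> {..<n}" "card (fst Sc) = Suc k" and c: "snd Sc \<in> {..<m} \<times> {..<m}"
      using that by (auto simp: subsets_def cells_def)
    have F: "{e. e \<subseteq> fst Sc \<and> card e = 2} \<subseteq> vertex_pairs n" using that by (intro pairs) auto
    have "card {e. e \<subseteq> fst Sc \<and> card e = 2} = Suc k choose 2"
      using n_subsets[of "fst Sc" 2] S finite_subset[OF S(1)] by simp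
    then show "measure ?M (bad Sc) = (1 / m\<^sup>2) ^ Suc k * (1 - p) ^ (Suc k choose 2)"
      unfolding bad_def prob_points_in_and_no_coins[OF S(1) F grid_cell_borel p]
      by (simp add: measure_uniform_point_grid_cell[OF c] S del: measure_uniform_measure)
    show "bad Sc \<in> sets ?M"
      unfolding bad_def by (rule event_points_in_and_no_coins[OF S(1) F grid_cell_borel])
  qed
  have out_sets: "out ` {..<n} \<subseteq> sets ?M" and bad_sets: "bad ` (subsets \<times> cells) \<subseteq> sets ?M"
    using out(1) bad(1) by blast+
  have "{\<omega> \<in> space ?M. m\<^sup>2 * k < independence_number {..<n} (random_graph n r \<omega>)}
      \<subseteq> (\<Union>v\<in>{..<n}. out v) \<union> (\<Union>Sc\<in>subsets \<times> cells. bad Sc)"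
  proof
    fix \<omega> assume \<omega>: "\<omega> \<in> {\<omega> \<in> space ?M. m\<^sup>2 * k < independence_number {..<n} (random_graph n r \<omega>)}"
    show "\<omega> \<in> (\<Union>v\<in>{..<n}. out v) \<union> (\<Union>Sc\<in>subsets \<times> cells. bad Sc)"
    proof (rule ccontr)
      assume "\<omega> \<notin> (\<Union>v\<in>{..<n}. out v) \<union> (\<Union>Sc\<in>subsets \<times> cells. bad Sc)"
      then have no: "\<And>v. v \<in> {..<n} \<Longrightarrow> \<omega> \<notin> out v" "\<And>Sc. Sc \<in> subsets \<times> cells \<Longrightarrow> \<omega> \<notin> bad Sc"
        by blast+
      have "independence_number {..<n} (random_graph n r (fst \<omega>, snd \<omega>)) \<le> m\<^sup>2 * k"
      proof (rule independence_number_le_grid[OF m])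
        fix v assume "v < n"
        then show "fst \<omega> v \<in> unit_square"
          using no(1)[of v] \<omega> by (simp add: out_def)
      next
        fix S c assume "S \<subseteq> {..<n}" "card S = Suc k" "c \<in> {..<m} \<times> {..<m}"
          "\<forall>v\<in>S. fst \<omega> v \<in> grid_cell m c"
        then show "\<exists>e. e \<subseteq> S \<and> card e = 2 \<and> snd \<omega> e"
          using no(2)[of "(S, c)"] \<omega> by (auto simp: bad_def subsets_def cells_def)
      qed
      then show False using \<omega> by simp
    qed
  qed
  then have "\<P>(\<omega> in ?M. m\<^sup>2 * k < independence_number {..<n} (random_graph n r \<omega>))
      \<le> measure ?M ((\<Union>v\<in>{..<n}. out v) \<union> (\<Union>Sc\<in>subsets \<times> cells. bad Sc))"
    using out_sets bad_sets fin
    by (intro M.finite_measure_mono sets.Un sets.finite_UN) auto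
  also have "\<dots> \<le> measure ?M (\<Union>v\<in>{..<n}. out v) + measure ?M (\<Union>Sc\<in>subsets \<times> cells. bad Sc)"
    using out_sets bad_sets fin
    by (intro measure_Un_le sets.finite_UN) auto
  also have "\<dots> \<le> (\<Sum>v\<in>{..<n}. measure ?M (out v)) + (\<Sum>Sc\<in>subsets \<times> cells. measure ?M (bad Sc))"
    using out_sets bad_sets fin
    by (intro add_mono M.finite_measure_subadditive_finite) auto
  also have "\<dots> = real (n choose Suc k) * real (m\<^sup>2) * ((1 / m\<^sup>2) ^ Suc k * (1 - p) ^ (Suc k choose 2))"
    using out(2) bad(2) n_subsets[of "{..<n}" "Suc k"]
    by (simp add: card_cartesian_product subsets_def cells_def power2_eq_square del: power_Suc binomial_Suc_Suc)
  also have "\<dots> \<le> real n ^ Suc k * real (m\<^sup>2) * ((1 / m\<^sup>2) ^ Suc k * (1 - p) ^ (Suc k choose 2))"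
    using binomial_le_power[of n "Suc k"] p
    by (intro mult_right_mono) (auto simp del: power_Suc binomial_Suc_Suc simp flip: of_nat_power)
  also have "\<dots> = real (m\<^sup>2) * (real n / (real m)\<^sup>2) ^ Suc k * (1 - p) ^ (Suc k choose 2)"
    by (simp add: power_divide)
  finally show ?thesis by (simp only: of_nat_power)
qed

text \<open>Union bound over cells and sets \<open>I\<close> of at most \<open>k\<close> vertices,
  for the event that \<open>I\<close> dominates all other vertices in the cell. If none of these
  events occurs, sets of size up to \<open>k\<close> can always be enlarged, so every cell yields
  \<open>Suc k\<close> vertices.\<close>

lemma prob_independence_number_less:
  assumes m: "m = 1 \<or> 0 < m \<and> 2 * real m * r < 1" and r: "0 < r" and p: "0 \<le> p" "p \<le> 1"
    and n: "1 \<le> n" "k \<le> n"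
  shows "\<P>(\<omega> in random_graph_space n p.
      independence_number {..<n} (random_graph n r \<omega>) < m\<^sup>2 * Suc k)
    \<le> real (m\<^sup>2) * (real (Suc k) * real n ^ k) * exp (- (real (n - k) * ((1 - p) ^ k / (4 * m\<^sup>2))))"
proof -
  interpret M: prob_space "random_graph_space n p" by (rule prob_space_random_graph_space)
  let ?M = "random_graph_space n p"
  define cells where "cells = {..<m} \<times> {..<m}"
  define subsets where "subsets = {I. I \<subseteq> {..<n} \<and> card I \<le> k}"
  define bad where "bad Ic = {\<omega> \<in> space ?M. \<forall>v\<in>{..<n} - fst Ic. fst \<omega> v \<in> half_cell m (snd Ic) \<longrightarrow>
      (\<exists>u\<in>fst Ic. snd \<omega> {u, v})}" for Ic
  define bound where "bound = exp (- (real (n - k) * ((1 - p) ^ k / (4 * m\<^sup>2))))"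
  have fin: "finite (subsets \<times> cells)" by (simp add: subsets_def cells_def)
  have bad: "bad Ic \<in> sets ?M" "measure ?M (bad Ic) \<le> bound"
    if "Ic \<in> subsets \<times> cells" for Ic
  proof -
    have I: "fst Ic \<subseteq> {..<n}" "card (fst Ic) \<le> k" and c: "snd Ic \<in> {..<m} \<times> {..<m}"
      using that by (auto simp: subsets_def cells_def)
    show "bad Ic \<in> sets ?M"
      unfolding bad_def by (rule event_cell_dominated[OF I(1) half_cell_borel])
    let ?x = "(1 - p) ^ card (fst Ic) / (4 * m\<^sup>2)"
    have m1: "1 \<le> real (m\<^sup>2)" using c by (cases m) auto
    have "?x \<le> 1 / 1"
      using p m1 by (intro frac_le power_le_one) auto
    then have x: "0 \<le> ?x" "?x \<le> 1" using p by auto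
    have "measure ?M (bad Ic) = (1 - ?x) ^ (n - card (fst Ic))"
      unfolding bad_def prob_cell_dominated[OF I(1) half_cell_borel p]
        measure_uniform_point_half_cell[OF c] by simp
    also have "\<dots> \<le> exp (- ?x) ^ (n - card (fst Ic))"
      using x exp_ge_add_one_self[of "- ?x"] by (intro power_mono) auto
    also have "\<dots> = exp (- (real (n - card (fst Ic)) * ?x))"
      by (simp flip: exp_of_nat_mult)
    \<comment> \<open>Both \<open>n - card (fst Ic)\<close> and
      \<open>(1 - p) ^ card (fst Ic)\<close> decrease with the size of the set, so size
      \<open>k\<close> is the worst case.\<close>
    also have "\<dots> \<le> bound"
      unfolding bound_def exp_le_cancel_iff neg_le_iff_le
      using I(2) n p by (intro mult_mono divide_right_mono power_decreasing) auto
    finally show "measure ?M (bad Ic) \<le> bound" .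
  qed
  have bad_sets: "bad ` (subsets \<times> cells) \<subseteq> sets ?M"
    using bad(1) by blast
  have "{\<omega> \<in> space ?M. independence_number {..<n} (random_graph n r \<omega>) < m\<^sup>2 * Suc k}
      \<subseteq> (\<Union>Ic\<in>subsets \<times> cells. bad Ic)"
  proof
    fix \<omega> assume \<omega>: "\<omega> \<in> {\<omega> \<in> space ?M. independence_number {..<n} (random_graph n r \<omega>) < m\<^sup>2 * Suc k}"
    show "\<omega> \<in> (\<Union>Ic\<in>subsets \<times> cells. bad Ic)"
    proof (rule ccontr)
      assume "\<omega> \<notin> (\<Union>Ic\<in>subsets \<times> cells. bad Ic)"
      then have no: "\<And>Ic. Ic \<in> subsets \<times> cells \<Longrightarrow> \<omega> \<notin> bad Ic"
        by blast
      have "m\<^sup>2 * Suc k \<le> independence_number {..<n} (random_graph n r (fst \<omega>, snd \<omega>))"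
      proof (rule independence_number_ge_grid[OF _ r])
        fix I c assume "I \<subseteq> {..<n}" "card I < Suc k" "c \<in> {..<m} \<times> {..<m}"
        then show "\<exists>v\<in>{..<n} - I. fst \<omega> v \<in> half_cell m c \<and> (\<forall>u\<in>I. \<not> snd \<omega> {u, v})"
          using no[of "(I, c)"] \<omega> by (auto simp: bad_def subsets_def cells_def)
      qed (use m in auto)
      then show False using \<omega> by simp
    qed
  qed
  then have "\<P>(\<omega> in ?M. independence_number {..<n} (random_graph n r \<omega>) < m\<^sup>2 * Suc k)
      \<le> measure ?M (\<Union>Ic\<in>subsets \<times> cells. bad Ic)"
    using bad_sets fin by (intro M.finite_measure_mono sets.finite_UN) auto
  also have "\<dots> \<le> (\<Sum>Ic\<in>subsets \<times> cells. measure ?M (bad Ic))"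
    using bad_sets fin by (intro M.finite_measure_subadditive_finite) auto
  also have "\<dots> \<le> real (card (subsets \<times> cells)) * bound"
    using bad(2) by (rule sum_bounded_above)
  also have "\<dots> = real (m\<^sup>2) * real (card subsets) * bound"
    by (simp add: card_cartesian_product cells_def power2_eq_square)
  also have "\<dots> \<le> real (m\<^sup>2) * real (Suc k * n ^ k) * bound"
    unfolding subsets_def using card_small_subsets_le[OF n(1), of k]
    by (intro mult_right_mono mult_left_mono of_nat_mono) (auto simp: bound_def)
  finally show ?thesis by (simp only: bound_def of_nat_mult of_nat_power)
qed

subsection \<open>Asymptotics\<close>

text \<open>Each of the \<open>Suc k\<close> vertices contributes a factor of at most
  \<open>N\<close> for the points and of at most \<open>(1 / N)\<^sup>2\<close> for the coins, so
  \<open>1 / N\<close> remains per vertex.\<close>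

lemma prob_independence_number_upper:
  fixes n :: nat and p r R :: real
  assumes p: "0 < p" "p < 1" and r: "0 < r" "r \<le> R"
  defines "N \<equiv> real n * r\<^sup>2"
  defines "L \<equiv> log (1 / (1 - p)) N"
  assumes N: "0 < N" and L: "1 \<le> L"
  shows "\<P>(\<omega> in random_graph_space n p.
      5 * (sqrt 2 + R)\<^sup>2 * (L / r\<^sup>2) < independence_number {..<n} (random_graph n r \<omega>))
    \<le> (sqrt 2 + R)\<^sup>2 / r\<^sup>2 * (1 / N) ^ Suc (nat \<lceil>4 * L\<rceil>)"
proof -
  interpret M: prob_space "random_graph_space n p" by (rule prob_space_random_graph_space)
  \<comment> \<open>The coarsest grid with \<open>sqrt 2 / m \<le> r\<close>.\<close>
  define m where "m = nat \<lceil>sqrt 2 / r\<rceil>"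
  \<comment> \<open>At least \<open>4 * L\<close> makes \<open>(1 - p) powr (k / 2)\<close> at most
    \<open>(1 / N)\<^sup>2\<close>; rounding up stays below \<open>5 * L\<close> because
    \<open>1 \<le> L\<close>, whence the 5 in the bound.\<close>
  define k where "k = nat \<lceil>4 * L\<rceil>"
  have q: "0 < 1 - p" "1 - p < 1" using p by auto
  have s: "0 < sqrt 2 / r" using r by simp
  then have m_ge: "sqrt 2 / r \<le> real m" and m_le: "real m \<le> sqrt 2 / r + 1"
    unfolding m_def by linarith+
  have m0: "0 < m" using s m_ge by (cases m) auto
  have mr: "sqrt 2 / m \<le> r"
    using m_ge m0 r by (simp add: field_simps)
  \<comment> \<open>The assumption \<open>r \<le> R\<close> absorbs the rounding error 1 of
    \<open>m\<close> into \<open>R / r\<close>.\<close>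
  have "sqrt 2 / r + 1 \<le> (sqrt 2 + R) / r"
    using r by (simp add: field_simps)
  then have "(real m)\<^sup>2 \<le> ((sqrt 2 + R) / r)\<^sup>2"
    using m_le by (intro power_mono) auto
  then have m2: "real (m\<^sup>2) \<le> (sqrt 2 + R)\<^sup>2 / r\<^sup>2"
    by (simp add: power_divide)
  have k_ge: "4 * L \<le> k" and k_le: "real k \<le> 5 * L"
    using L unfolding k_def by linarith+
  have "(sqrt 2 / r)\<^sup>2 \<le> (real m)\<^sup>2"
    using m_ge s by (intro power_mono) auto
  then have "2 / r\<^sup>2 \<le> (real m)\<^sup>2" by (simp add: power_divide)
  then have "2 \<le> (real m)\<^sup>2 * r\<^sup>2" using r by (simp add: field_simps)
  then have "real n * 1 \<le> real n * ((real m)\<^sup>2 * r\<^sup>2)"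
    by (intro mult_left_mono) auto
  then have nm: "real n / (real m)\<^sup>2 \<le> N"
    using m0 by (simp add: N_def field_simps)
  have qk: "(1 - p) ^ (Suc k choose 2) \<le> ((1 / N)\<^sup>2) ^ Suc k"
  proof -
    \<comment> \<open>The exponent is shared evenly: \<open>k / 2\<close> for each of the
      \<open>Suc k\<close> factors.\<close>
    have "real (Suc k choose 2) = real k / 2 * real (Suc k)"
      by (simp add: choose_two real_of_nat_div algebra_simps)
    moreover have "(1 - p) ^ (Suc k choose 2) = (1 - p) powr real (Suc k choose 2)"
      using q by (simp only: powr_realpow)
    ultimately have "(1 - p) ^ (Suc k choose 2) = ((1 - p) powr (k / 2)) powr real (Suc k)"
      by (simp only: powr_powr)
    also have "\<dots> = ((1 - p) powr (k / 2)) ^ Suc k"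
      using q by (intro powr_realpow) simp
    also have "\<dots> \<le> ((1 - p) powr (2 * L)) ^ Suc k"
      using q k_ge by (intro power_mono powr_mono') auto
    also have "(1 - p) powr (2 * L) = inverse ((1 / (1 - p)) powr L) powr 2"
      using q by (simp add: powr_divide powr_powr mult.commute)
    also have "(1 / (1 - p)) powr L = N"
      unfolding L_def using q N by (intro powr_log_cancel) auto
    also have "inverse N powr 2 = (1 / N)\<^sup>2"
      using N by (simp add: inverse_eq_divide powr_numeral)
    finally show ?thesis .
  qed
  have "real (m\<^sup>2 * k) \<le> (sqrt 2 + R)\<^sup>2 / r\<^sup>2 * (5 * L)"
    unfolding of_nat_mult using m2 k_le by (intro mult_mono) auto
  then have size: "real (m\<^sup>2 * k) \<le> 5 * (sqrt 2 + R)\<^sup>2 * (L / r\<^sup>2)"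
    by (simp add: mult_ac)
  have "\<P>(\<omega> in random_graph_space n p.
      5 * (sqrt 2 + R)\<^sup>2 * (L / r\<^sup>2) < independence_number {..<n} (random_graph n r \<omega>))
    \<le> \<P>(\<omega> in random_graph_space n p.
      m\<^sup>2 * k < independence_number {..<n} (random_graph n r \<omega>))"
  proof (intro M.finite_measure_mono subsetI
      random_graph_event[where Q = "\<lambda>G. m\<^sup>2 * k < independence_number {..<n} G"])
    fix \<omega> assume "\<omega> \<in> {\<omega> \<in> space (random_graph_space n p).
      5 * (sqrt 2 + R)\<^sup>2 * (L / r\<^sup>2) < independence_number {..<n} (random_graph n r \<omega>)}"
    then have "\<omega> \<in> space (random_graph_space n p)"
      "real (m\<^sup>2 * k) < real (independence_number {..<n} (random_graph n r \<omega>))"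
      using size by auto
    then show "\<omega> \<in> {\<omega> \<in> space (random_graph_space n p).
      m\<^sup>2 * k < independence_number {..<n} (random_graph n r \<omega>)}"
      unfolding of_nat_less_iff by blast
  qed
  also have "\<dots> \<le> real (m\<^sup>2) * (real n / (real m)\<^sup>2) ^ Suc k * (1 - p) ^ (Suc k choose 2)"
    using p by (intro prob_independence_number_gt m0 mr) auto
  also have "\<dots> \<le> (sqrt 2 + R)\<^sup>2 / r\<^sup>2 * N ^ Suc k * ((1 / N)\<^sup>2) ^ Suc k"
    using m2 nm qk q N by (intro mult_mono power_mono) auto
  also have "\<dots> = (sqrt 2 + R)\<^sup>2 / r\<^sup>2 * (N * (1 / N)\<^sup>2) ^ Suc k"
    by (simp only: power_mult_distrib mult.assoc)
  also have "N * (1 / N)\<^sup>2 = 1 / N"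
    using N by (simp add: power2_eq_square)
  finally show ?thesis unfolding k_def .
qed

text \<open>Since \<open>(1 - p) ^ k\<close> is at least \<open>1 / sqrt N\<close>, a half cell is
  expected to hold at least order \<open>sqrt N\<close> vertices without a coin edge to a given set
  of \<open>k\<close> vertices. The exponential of minus this order is set against the number of
  such sets, about \<open>n powr (L / 2)\<close>.\<close>

lemma prob_independence_number_lower:
  fixes n :: nat and p r R :: real
  assumes p: "0 < p" "p < 1" and r: "0 < r" "r \<le> R" and R: "1 \<le> R"
  defines "N \<equiv> real n * r\<^sup>2"
  defines "L \<equiv> log (1 / (1 - p)) N"
  assumes N: "1 \<le> N" and Ln: "L \<le> real n"
  shows "\<P>(\<omega> in random_graph_space n p.
      independence_number {..<n} (random_graph n r \<omega>) < 1 / 72 * (L / r\<^sup>2))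
    \<le> (R / r)\<^sup>2 * (L / 2 + 1) * real n powr (L / 2) * exp (- (sqrt N / (8 * R\<^sup>2)))"
proof -
  interpret M: prob_space "random_graph_space n p" by (rule prob_space_random_graph_space)
  \<comment> \<open>The 3 gives \<open>2 * m * r \<le> 2 / 3\<close> when \<open>m > 1\<close>,
    hence separated half cells; for large \<open>r\<close> the floor is 0 and a single cell is
    taken.\<close>
  define m where "m = max 1 (nat \<lfloor>1 / (3 * r)\<rfloor>)"
  define k where "k = nat \<lfloor>L / 2\<rfloor>"
  have q: "0 < 1 - p" "1 - p < 1" using p by auto
  have n: "1 \<le> n" using N by (cases n) (auto simp: N_def)
  have L: "0 \<le> L" unfolding L_def using q N by (intro zero_le_log_cancel_iff[THEN iffD2]) auto
  have k_le: "real k \<le> L / 2" and k_ge: "L / 2 \<le> real (Suc k)"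
    using L unfolding k_def by linarith+
  have kn: "2 * k \<le> n" using k_le Ln by linarith
  have t: "0 < 1 / (3 * r)" using r by simp
  have m_le: "m = 1 \<or> real m \<le> 1 / (3 * r)" and m_ge: "1 \<le> real m" "1 / (3 * r) - 1 \<le> real m"
    using t unfolding m_def by (auto simp: max_def) linarith+
  have sep: "m = 1 \<or> 0 < m \<and> 2 * real m * r < 1"
    using m_le m_ge r by (auto simp: field_simps)
  \<comment> \<open>With \<open>x = 1 / (3 * r)\<close>, \<open>m\<close> is at least the larger of
    1 and \<open>x - 1\<close>, hence at least \<open>x / 2\<close>. The resulting 36, together with
    \<open>L / 2 \<le> Suc k\<close>, gives the constant \<open>1 / 72\<close>.\<close>
  have "1 / (6 * r) = 1 / (3 * r) / 2" by simp
  then have "1 / (6 * r) \<le> real m"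
    using m_ge by linarith
  then have "(1 / (6 * r))\<^sup>2 \<le> (real m)\<^sup>2"
    using r by (intro power_mono) auto
  then have m2_ge: "1 / (36 * r\<^sup>2) \<le> (real m)\<^sup>2"
    by (simp add: power2_eq_square)
  \<comment> \<open>Either \<open>m = 1\<close> and \<open>r \<le> R\<close> applies, or
    \<open>m * r \<le> 1 / 3\<close>, which is below \<open>R\<close> because
    \<open>1 \<le> R\<close>.\<close>
  have "real m * r \<le> R"
    using m_le r R by (auto simp: field_simps)
  then have mR: "real m \<le> R / r"
    using r by (simp add: field_simps)
  then have m2_le: "real (m\<^sup>2) \<le> (R / r)\<^sup>2"
    by (simp add: power_mono)
  have qk: "1 / sqrt N \<le> (1 - p) ^ k"
  proof -
    have "(1 / (1 - p)) powr L = N"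
      unfolding L_def using q N by (intro powr_log_cancel) auto
    then have "1 / sqrt N = inverse (((1 / (1 - p)) powr L) powr (1 / 2))"
      using N by (simp add: powr_half_sqrt inverse_eq_divide)
    also have "inverse (((1 / (1 - p)) powr L) powr (1 / 2)) = (1 - p) powr (L / 2)"
      using q by (simp add: powr_divide powr_powr)
    also have "\<dots> \<le> (1 - p) powr k"
      using q k_le by (intro powr_mono') auto
    also have "\<dots> = (1 - p) ^ k"
      using q by (simp add: powr_realpow)
    finally show ?thesis .
  qed
  have expo: "sqrt N / (8 * R\<^sup>2) \<le> real (n - k) * ((1 - p) ^ k / (4 * m\<^sup>2))"
  proof -
    \<comment> \<open>The right-hand side is arranged for the three estimates
      \<open>n / 2 \<le> n - k\<close>, \<open>1 / sqrt N \<le> (1 - p) ^ k\<close> and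
      \<open>m \<le> R / r\<close>.\<close>
    have "sqrt N / (8 * R\<^sup>2) = (real n / 2) * ((1 / sqrt N) / (4 * (R / r)\<^sup>2))"
      using r R N real_sqrt_mult_self[of N]
      by (simp add: field_simps power_divide) (simp add: N_def power2_eq_square)
    also have "\<dots> \<le> real (n - k) * ((1 - p) ^ k / (4 * m\<^sup>2))"
      using kn qk m2_le m_ge q N r R by (intro mult_mono frac_le) auto
    finally show ?thesis .
  qed
  have "1 / 72 * (L / r\<^sup>2) = 1 / (36 * r\<^sup>2) * (L / 2)"
    by simp
  also have "\<dots> \<le> (real m)\<^sup>2 * real (Suc k)"
    using m2_ge k_ge L r by (intro mult_mono) auto
  finally have size: "1 / 72 * (L / r\<^sup>2) \<le> real (m\<^sup>2 * Suc k)"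
    by (simp only: of_nat_mult of_nat_power)
  have "\<P>(\<omega> in random_graph_space n p.
      independence_number {..<n} (random_graph n r \<omega>) < 1 / 72 * (L / r\<^sup>2))
    \<le> \<P>(\<omega> in random_graph_space n p.
      independence_number {..<n} (random_graph n r \<omega>) < m\<^sup>2 * Suc k)"
  proof (intro M.finite_measure_mono subsetI
      random_graph_event[where Q = "\<lambda>G. independence_number {..<n} G < m\<^sup>2 * Suc k"])
    fix \<omega> assume "\<omega> \<in> {\<omega> \<in> space (random_graph_space n p).
      independence_number {..<n} (random_graph n r \<omega>) < 1 / 72 * (L / r\<^sup>2)}"
    then have "\<omega> \<in> space (random_graph_space n p)"
      "real (independence_number {..<n} (random_graph n r \<omega>)) < real (m\<^sup>2 * Suc k)"
      using size by auto
    then show "\<omega> \<in> {\<omega> \<in> space (random_graph_space n p).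
      independence_number {..<n} (random_graph n r \<omega>) < m\<^sup>2 * Suc k}"
      unfolding of_nat_less_iff by blast
  qed
  also have "\<dots> \<le> real (m\<^sup>2) * (real (Suc k) * real n ^ k) * exp (- (real (n - k) * ((1 - p) ^ k / (4 * m\<^sup>2))))"
    using p r n kn by (intro prob_independence_number_less sep) auto
  also have "\<dots> \<le> (R / r)\<^sup>2 * ((L / 2 + 1) * real n powr (L / 2)) * exp (- (sqrt N / (8 * R\<^sup>2)))"
  proof (intro mult_mono)
    have "real n ^ k = real n powr k" using n by (simp add: powr_realpow)
    also have "\<dots> \<le> real n powr (L / 2)" using n k_le by (intro powr_mono) auto
    finally show "real n ^ k \<le> real n powr (L / 2)" .
  qed (use m2_le k_le L expo in auto)
  finally show ?thesis by (simp only: mult.assoc)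
qed

text \<open>Eliminates \<open>r\<close> from the error terms: \<open>1 / r\<^sup>2 \<le> n\<close>,
  \<open>n powr \<epsilon> \<le> N\<close> and \<open>L \<le> U\<close> bound both failure
  probabilities by expressions in \<open>n\<close>, so one limit serves all radius
  sequences.\<close>

lemma prob_independence_number_between:
  fixes n :: nat and \<epsilon> p r R :: real
  defines "B \<equiv> ln (1 / (1 - p))"
  defines "U \<equiv> (ln (real n) + 2 * ln R) / B"
  assumes p: "0 < p" "p < 1" and \<epsilon>: "0 < \<epsilon>" and R: "1 \<le> R"
    and r: "0 < r" "r \<le> R" and nr: "real n powr \<epsilon> \<le> real n * r\<^sup>2"
    and n: "1 \<le> n" "1 + 1 / \<epsilon> \<le> \<epsilon> * ln (real n) / B" "U \<le> real n"
  shows "1 - ((sqrt 2 + R)\<^sup>2 * real n * real n powr - 2 +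
      R\<^sup>2 * real n * (U / 2 + 1) * real n powr (U / 2) * exp (- (real n powr (\<epsilon> / 2) / (8 * R\<^sup>2))))
    \<le> \<P>(\<omega> in random_graph_space n p.
        1 / 72 * (log (1 / (1 - p)) (real n * r\<^sup>2) / r\<^sup>2)
          \<le> real (independence_number {..<n} (random_graph n r \<omega>)) \<and>
        real (independence_number {..<n} (random_graph n r \<omega>))
          \<le> 5 * (sqrt 2 + R)\<^sup>2 * (log (1 / (1 - p)) (real n * r\<^sup>2) / r\<^sup>2))"
proof -
  interpret M: prob_space "random_graph_space n p" by (rule prob_space_random_graph_space)
  define N where "N = real n * r\<^sup>2"
  define L where "L = log (1 / (1 - p)) N"
  let ?M = "random_graph_space n p"
  let ?\<alpha> = "\<lambda>\<omega>. real (independence_number {..<n} (random_graph n r \<omega>))"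
  let ?lo = "1 / 72 * (L / r\<^sup>2)" and ?hi = "5 * (sqrt 2 + R)\<^sup>2 * (L / r\<^sup>2)"
  have B: "0 < B" unfolding B_def using p by simp
  have L_eq: "L = ln N / B" by (simp add: L_def log_def B_def)
  have N_ge: "real n powr \<epsilon> \<le> N" using nr by (simp add: N_def)
  have "1 \<le> real n powr \<epsilon>" using n(1) \<epsilon> by (simp add: ge_one_powr_ge_zero)
  then have N: "1 \<le> N" using N_ge by linarith
  have "\<epsilon> * ln (real n) = ln (real n powr \<epsilon>)" using n(1) by (simp add: ln_powr)
  also have "\<dots> \<le> ln N" using N_ge n(1) by (intro ln_mono) auto
  finally have "\<epsilon> * ln (real n) / B \<le> L"
    unfolding L_eq using B by (intro divide_right_mono) auto
  \<comment> \<open>This serves twice: it gives \<open>1 \<le> L\<close>, and also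
    \<open>2 / \<epsilon> \<le> 4 * L\<close>, the exponent that turns
    \<open>n powr - \<epsilon>\<close> into \<open>n powr - 2\<close>.\<close>
  then have L: "1 + 1 / \<epsilon> \<le> L" using n(2) by linarith
  have L1: "1 \<le> L" using L \<epsilon> by (smt (verit) divide_pos_pos)
  have "N \<le> real n * R\<^sup>2"
    unfolding N_def using r by (intro mult_left_mono power_mono) auto
  then have "ln N \<le> ln (real n * R\<^sup>2)" using N by (intro ln_mono) auto
  also have "\<dots> = ln (real n) + 2 * ln R"
    using n(1) R by (simp add: ln_mult ln_realpow)
  finally have LU: "L \<le> U"
    unfolding L_eq U_def using B by (intro divide_right_mono) auto
  have inv_r: "1 / r\<^sup>2 \<le> real n"
  proof -
    have "1 / r\<^sup>2 \<le> N / r\<^sup>2" using N by (intro divide_right_mono) auto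
    then show ?thesis using r by (simp add: N_def)
  qed
  have hi: "\<P>(\<omega> in ?M. ?hi < ?\<alpha> \<omega>) \<le> (sqrt 2 + R)\<^sup>2 * real n * real n powr - 2"
  proof -
    have "\<P>(\<omega> in ?M. ?hi < ?\<alpha> \<omega>) \<le> (sqrt 2 + R)\<^sup>2 / r\<^sup>2 * (1 / N) ^ Suc (nat \<lceil>4 * L\<rceil>)"
      using prob_independence_number_upper[of p r R n] p r N L1 unfolding L_def N_def by simp
    also have "\<dots> = (sqrt 2 + R)\<^sup>2 * (1 / r\<^sup>2) * (1 / N) ^ Suc (nat \<lceil>4 * L\<rceil>)"
      by simp
    also have "\<dots> \<le> (sqrt 2 + R)\<^sup>2 * real n * real n powr - 2"
    proof (intro mult_mono inv_r)
      have "2 / \<epsilon> = 2 * (1 / \<epsilon>)" "0 < 1 / \<epsilon>" using \<epsilon> by auto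
      then have "2 / \<epsilon> \<le> 4 * L" using L by linarith
      then have e: "2 / \<epsilon> \<le> real (Suc (nat \<lceil>4 * L\<rceil>))" by linarith
      have "(1 / N) ^ Suc (nat \<lceil>4 * L\<rceil>) = (1 / N) powr real (Suc (nat \<lceil>4 * L\<rceil>))"
        using N by (intro powr_realpow[symmetric]) auto
      also have "\<dots> \<le> (1 / N) powr (2 / \<epsilon>)"
        using N e by (intro powr_mono') auto
      also have "\<dots> \<le> (1 / real n powr \<epsilon>) powr (2 / \<epsilon>)"
        using N N_ge n(1) \<epsilon> by (intro powr_mono2 frac_le) auto
      also have "1 / real n powr \<epsilon> = real n powr - \<epsilon>"
        by (simp add: powr_minus_divide)
      also have "(real n powr - \<epsilon>) powr (2 / \<epsilon>) = real n powr - 2"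
        using \<epsilon> by (simp add: powr_powr)
      finally show "(1 / N) ^ Suc (nat \<lceil>4 * L\<rceil>) \<le> real n powr - 2" .
    qed (use N in auto)
    finally show ?thesis .
  qed
  have lo: "\<P>(\<omega> in ?M. ?\<alpha> \<omega> < ?lo) \<le>
      R\<^sup>2 * real n * (U / 2 + 1) * real n powr (U / 2) * exp (- (real n powr (\<epsilon> / 2) / (8 * R\<^sup>2)))"
  proof -
    have "L \<le> real n" using LU n(3) by linarith
    then have "\<P>(\<omega> in ?M. ?\<alpha> \<omega> < ?lo) \<le>
        (R / r)\<^sup>2 * (L / 2 + 1) * real n powr (L / 2) * exp (- (sqrt N / (8 * R\<^sup>2)))"
      using prob_independence_number_lower[of p r R n] p r R N unfolding L_def N_def by simp
    also have "(R / r)\<^sup>2 = R\<^sup>2 * (1 / r\<^sup>2)"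
      by (simp add: power_divide)
    also have "R\<^sup>2 * (1 / r\<^sup>2) * (L / 2 + 1) * real n powr (L / 2) * exp (- (sqrt N / (8 * R\<^sup>2))) \<le>
        R\<^sup>2 * real n * (U / 2 + 1) * real n powr (U / 2) * exp (- (real n powr (\<epsilon> / 2) / (8 * R\<^sup>2)))"
    proof (intro mult_mono inv_r)
      have "real n powr (\<epsilon> / 2) = sqrt (real n powr \<epsilon>)"
        by (simp add: powr_powr flip: powr_half_sqrt)
      also have "\<dots> \<le> sqrt N" using N_ge by (rule real_sqrt_le_mono)
      finally show "exp (- (sqrt N / (8 * R\<^sup>2))) \<le> exp (- (real n powr (\<epsilon> / 2) / (8 * R\<^sup>2)))"
        by (simp add: divide_right_mono)
      show "real n powr (L / 2) \<le> real n powr (U / 2)"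
        using n(1) LU by (intro powr_mono) auto
    qed (use L1 LU in auto)
    finally show ?thesis .
  qed
  have sets: "{\<omega> \<in> space ?M. ?hi < ?\<alpha> \<omega>} \<in> sets ?M" "{\<omega> \<in> space ?M. ?\<alpha> \<omega> < ?lo} \<in> sets ?M"
    "{\<omega> \<in> space ?M. ?lo \<le> ?\<alpha> \<omega> \<and> ?\<alpha> \<omega> \<le> ?hi} \<in> sets ?M"
    by (rule random_graph_event)+
  have "space ?M = {\<omega> \<in> space ?M. ?lo \<le> ?\<alpha> \<omega> \<and> ?\<alpha> \<omega> \<le> ?hi} \<union>
      ({\<omega> \<in> space ?M. ?hi < ?\<alpha> \<omega>} \<union> {\<omega> \<in> space ?M. ?\<alpha> \<omega> < ?lo})"
    by (auto simp only: mem_Collect_eq Un_iff not_le)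
  then have "1 = measure ?M ({\<omega> \<in> space ?M. ?lo \<le> ?\<alpha> \<omega> \<and> ?\<alpha> \<omega> \<le> ?hi} \<union>
      ({\<omega> \<in> space ?M. ?hi < ?\<alpha> \<omega>} \<union> {\<omega> \<in> space ?M. ?\<alpha> \<omega> < ?lo}))"
    using M.prob_space by simp
  also have "\<dots> \<le> \<P>(\<omega> in ?M. ?lo \<le> ?\<alpha> \<omega> \<and> ?\<alpha> \<omega> \<le> ?hi) +
      (\<P>(\<omega> in ?M. ?hi < ?\<alpha> \<omega>) + \<P>(\<omega> in ?M. ?\<alpha> \<omega> < ?lo))"
    using sets by (intro order_trans[OF measure_Un_le] add_left_mono measure_Un_le sets.Un)
  finally show ?thesis
    using hi lo unfolding L_def N_def by linarith
qed

text \<open>The constants precede \<open>r\<close>, hence are uniform over all radius sequences.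
  Beyond the diameter of the torus a larger radius almost surely leaves the graph unchanged, while
  the formula tends to 0 for fixed \<open>n\<close>; hence the fixed but arbitrary bound
  \<open>R\<close>, on which \<open>C\<close> may depend.\<close>

theorem theorem4:
  fixes \<epsilon> p R :: real
  assumes "\<epsilon> > 0" and "0 < p" and "p < 1"
  shows "\<exists>c>0. \<exists>C>0. \<forall>r :: nat \<Rightarrow> real.
    (\<forall>\<^sub>F n in sequentially. 0 < r n \<and> r n \<le> R \<and> real n * (r n)\<^sup>2 \<ge> real n powr \<epsilon>) \<longrightarrow>
    (\<lambda>n. \<P>(\<omega> in random_graph_space n p.
        c * (log (1 / (1 - p)) (real n * (r n)\<^sup>2) / (r n)\<^sup>2)
          \<le> real (independence_number {..<n} (random_graph n (r n) \<omega>)) \<and>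
        real (independence_number {..<n} (random_graph n (r n) \<omega>))
          \<le> C * (log (1 / (1 - p)) (real n * (r n)\<^sup>2) / (r n)\<^sup>2)))
      \<longlonglongrightarrow> 1"
proof -
  \<comment> \<open>The maximum provides the lower bound 1 that the estimates assume, whatever
    \<open>R\<close> is.\<close>
  define R' where "R' = max R 1"
  define B where "B = ln (1 / (1 - p))"
  define D where "D = 2 * ln R'"
  define E where "E = 8 * R'\<^sup>2"
  define U where "U n = (ln (real n) + D) / B" for n
  define bound where "bound n = (sqrt 2 + R')\<^sup>2 * real n * real n powr - 2 +
      R'\<^sup>2 * real n * (U n / 2 + 1) * real n powr (U n / 2) * exp (- (real n powr (\<epsilon> / 2) / E))" for n
  have R': "1 \<le> R'" "R \<le> R'" by (auto simp: R'_def)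
  have B: "0 < B" using assms by (simp add: B_def)
  have E: "0 < E" using R' by (simp add: E_def)
  \<comment> \<open>The first error term is of order \<open>1 / n\<close>. In the second,
    \<open>n powr (U n / 2)\<close> grows like the exponential of a multiple of
    \<open>(ln n)\<^sup>2\<close>, which \<open>exp (- (n powr (\<epsilon> / 2) / E))\<close>
    outweighs.\<close>
  have "(\<lambda>n. 1 - bound n) \<longlonglongrightarrow> 1"
    unfolding bound_def U_def using \<open>\<epsilon> > 0\<close> B E by real_asymp
  have "\<forall>\<^sub>F n :: nat in sequentially. 1 + 1 / \<epsilon> \<le> \<epsilon> * ln (real n) / B"
    using \<open>\<epsilon> > 0\<close> B by real_asymp
  moreover have "\<forall>\<^sub>F n in sequentially. U n \<le> real n"
    unfolding U_def using B by real_asymp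
  ultimately have large: "\<forall>\<^sub>F n in sequentially. 1 \<le> n \<and> 1 + 1 / \<epsilon> \<le> \<epsilon> * ln (real n) / B \<and> U n \<le> real n"
    using eventually_ge_at_top[of "1::nat"] by eventually_elim auto
  show ?thesis
  proof (rule exI[of _ "1 / 72"], intro conjI, simp, rule exI[of _ "5 * (sqrt 2 + R')\<^sup>2"],
      intro conjI allI impI)
    show "0 < 5 * (sqrt 2 + R')\<^sup>2"
      using R' by (intro mult_pos_pos zero_less_power add_pos_pos) auto
    fix r :: "nat \<Rightarrow> real"
    assume r: "\<forall>\<^sub>F n in sequentially. 0 < r n \<and> r n \<le> R \<and> real n powr \<epsilon> \<le> real n * (r n)\<^sup>2"
    let ?P = "\<lambda>n. \<P>(\<omega> in random_graph_space n p.
        1 / 72 * (log (1 / (1 - p)) (real n * (r n)\<^sup>2) / (r n)\<^sup>2)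
          \<le> real (independence_number {..<n} (random_graph n (r n) \<omega>)) \<and>
        real (independence_number {..<n} (random_graph n (r n) \<omega>))
          \<le> 5 * (sqrt 2 + R')\<^sup>2 * (log (1 / (1 - p)) (real n * (r n)\<^sup>2) / (r n)\<^sup>2))"
    show "?P \<longlonglongrightarrow> 1"
    proof (rule tendsto_sandwich)
      show "\<forall>\<^sub>F n in sequentially. 1 - bound n \<le> ?P n"
        using r large
      proof eventually_elim
        case (elim n)
        then show ?case
          unfolding bound_def U_def D_def E_def B_def using assms R'
          by (intro prob_independence_number_between) (auto simp: B_def)
      qed
      show "\<forall>\<^sub>F n in sequentially. ?P n \<le> 1"
        by (intro always_eventually allI prob_space.prob_le_1 prob_space_random_graph_space)
      show "(\<lambda>n. 1 - bound n) \<longlonglongrightarrow> 1" by fact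
    qed simp
  qed
qed

end
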